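(* Let $f:\mathbb{R}^n\to\mathbb{R}$, $h:\mathbb{R}^n\to\mathbb{R}^{m_h}$, $g:\mathbb{R}^n\to\mathbb{R}^{m_g}$, $H:\mathbb{R}^n\to\mathbb{R}^m$ and $G:\mathbb{R}^n\to\mathbb{R}^m$ be twice differentiable in a neighborhood of $\bar w\in\mathbb{R}^n$, with second derivatives continuous at $\bar w$. Let $\bar w$ be a local solution of the MPCC $$\min_{w\in\mathbb{R}^n} f(w)\quad\text{s.t.}\quad h(w)=0,\ g(w)\le0,\ 0\le G(w)\perp H(w)\ge0,$$ satisfying MPCC--LICQ and MPCC--SSOSC with the associated unique Lagrange multiplier $(\bar\lambda,\bar\mu,\bar\xi,\bar\nu)$, and let $\bar z=(\bar w,\bar\lambda,\bar\mu,\bar\xi,\bar\nu)$ (so $\bar w$ is S-stationary). Let $\gamma>0$ be the maximum of the Lipschitz constants $\gamma^{\mathcal{I}}$, $\mathcal{I}\in\mathcal{P}(\bar w)$, of the solution maps of the perturbed branch NLPs (defined in the context). Suppose there exist $\omega>0$, $\bar\kappa<\frac1{3\gamma}$ and a sequence $\{\kappa^k\}$ with $\kappa^k\in[0,\bar\kappa]$ such that, for all $z^k$ and $z$, $$\|\nabla\Psi(z)^\top-\nabla\Psi(z^k)^\top\|\le\omega\|z-z^k\|,\qquad\|\nabla\Psi(z^k)^\top-\nabla\tilde\Psi(z^k)^\top\|\le\kappa^k.$$ Assume, in addition, that every non-S-stationary point $\tilde z=(\tilde w,\tilde\lambda,\tilde\mu,\tilde\xi,\tilde\nu)$ with $\tilde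 w$ sufficiently close to $\bar w$ satisfies $$\tilde\xi_i\neq0\quad\text{and}\quad\tilde\nu_i\neq0\qquad\forall i\in\mathcal{I}_{00}(\tilde w).$$ Then there exist $\varepsilon>0$ and a set $U\supseteq\mathcal{B}_\varepsilon(\bar z)$ such that for every $z^0\in U$ there exists a sequence of SQPCC iterates starting at $z^0$ and converging to $\bar z$ with $\|z^{k+1}-\bar z\|\le\alpha^k\|z^k-\bar z\|+\beta\|z^k-\bar z\|^2$ for some $\alpha^k\in[0,1)$, $\beta>0$ (with $\alpha^k\to0$ and superlinear convergence if $\kappa^k\to0$, and $\alpha^k=0$ and quadratic convergence if $\bar\kappa=0$), and such that, moreover: (1) there exists no sequence of SQPCC iterates starting in $U$ that converges to a non-S-stationary point $\tilde w$; (2) if, in addition, all QPCC iterates are chosen as S-stationary points contained in $U$ (that is, $\{z^k\}\subset U$ is a sequence of SQPCC iterates), then every such sequence converges to $\bar z$.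
   Context: $\mathcal{B}_\varepsilon(\bar z)$ is the open ball of radius $\varepsilon$ around $\bar z$; $\nabla F(w)$ is the transpose of the Jacobian of $F$. The constraint $0\le G(w)\perp H(w)\ge0$ means $G(w)\ge0$, $H(w)\ge0$ and $G_i(w)H_i(w)=0$, $i=1,\dots,m$. Index sets at a feasible $w$: $\mathcal{A}(w)=\{i\mid g_i(w)=0\}$, $\mathcal{A}_+(w,\mu)=\{i\in\mathcal{A}(w)\mid\mu_i>0\}$, $\mathcal{I}_{0+}(w)=\{i\mid G_i(w)=0,H_i(w)>0\}$, $\mathcal{I}_{+0}(w)=\{i\mid G_i(w)>0,H_i(w)=0\}$, $\mathcal{I}_{00}(w)=\{i\mid G_i(w)=H_i(w)=0\}$. Partitions: $\mathcal{P}(w)=\{\mathcal{I}_{0+}(w)\cup\tilde{\mathcal{I}}\mid\tilde{\mathcal{I}}\subseteq\mathcal{I}_{00}(w)\}$; $\mathcal{I}^{\mathrm C}=\{1,\dots,m\}\setminus\mathcal{I}$. MPCC--Lagrangian: $\mathcal{L}(w,\lambda,\mu,\xi,\nu)=f(w)+\lambda^\top h(w)+\mu^\top g(w)-\xi^\top G(w)-\nu^\top H(w)$. Stationarity: a feasible $w$ is W-stationary with MPCC--Lagrange multipliers $(\lambda,\mu,\xi,\nu)$ if $\nabla_w\mathcal{L}=0$, $0\le\mu\perp-g(w)\ge0$, $\nu_i=0$ for $i\in\mathcal{I}_{0+}(w)$ and $\xi_i=0$ for $i\in\mathcal{I}_{+0}(w)$ (no sign restrictions on $\xi_i,\nu_i$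 for $i\in\mathcal{I}_{00}(w)$). It is S-stationary if in addition $\xi_i\ge0$ and $\nu_i\ge0$ for all $i\in\mathcal{I}_{00}(w)$. A non-S-stationary point $\tilde z=(\tilde w,\tilde\lambda,\tilde\mu,\tilde\xi,\tilde\nu)$ means a W-stationary point of the MPCC with its multipliers that is not S-stationary, i.e. $\tilde\xi_i<0$ or $\tilde\nu_i<0$ for at least one $i\in\mathcal{I}_{00}(\tilde w)$. MPCC--LICQ at $w$: the gradients $\nabla h_i(w)$ (all $i$), $\nabla g_i(w)$ ($i\in\mathcal{A}(w)$), $\nabla G_i(w)$ ($i\in\mathcal{I}_{0+}(w)\cup\mathcal{I}_{00}(w)$), $\nabla H_i(w)$ ($i\in\mathcal{I}_{+0}(w)\cup\mathcal{I}_{00}(w)$) are linearly independent. MPCC--SSOSC at an S-stationary $\bar w$ with multipliers $(\bar\lambda,\bar\mu,\bar\xi,\bar\nu)$: $d^\top\nabla^2_{ww}\mathcal{L}(\bar w,\bar\lambda,\bar\mu,\bar\xi,\bar\nu)d>0$ for all nonzero $d$ in the union over $\mathcal{I}\in\mathcal{P}(\bar w)$ of the sets of $d\in\mathbb{R}^n$ with $\nabla h(\bar w)^\top d=0$; $\nabla g_i(\bar w)^\top d=0$ for $i\in\mathcal{A}_+(\bar w,\bar\mu)$; $\nabla G_i(\bar w)^\top d=0$ for $i\in\mathcal{I}\cup\{j\in\mathcal{I}^{\mathrm C}\mid\bar\xi_j>0\}$; $\nabla H_i(\bar w)^\top d=0$ for $i\in\mathcal{I}^{\mathrm C}\cup\{j\in\mathcal{I}\mid\bar\nu_j>0\}$.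 With $z=(w,\lambda,\mu,\xi,\nu)$, let $\Psi(z)=(\nabla_w\mathcal{L}(w,\lambda,\mu,\xi,\nu),h(w),-g(w),G(w),H(w))$, with Jacobian $\nabla\Psi(z)^\top$. $\nabla\tilde\Psi(z^k)^\top$ is obtained from $\nabla\Psi(z^k)^\top$ by replacing the block $\nabla^2_{ww}\mathcal{L}(z^k)$ by the Hessian approximation $M^k$ used at $z^k$. QPCC at $z^k$, with $M^k$ positive definite: $$\min_{\Delta w\in\mathbb{R}^n}\nabla f(w^k)^\top\Delta w+\tfrac12\Delta w^\top M^k\Delta w\ \ \text{s.t.}\ \ h(w^k)+\nabla h(w^k)^\top\Delta w=0,\ g(w^k)+\nabla g(w^k)^\top\Delta w\le0,$$ $$0\le G(w^k)+\nabla G(w^k)^\top\Delta w\perp H(w^k)+\nabla H(w^k)^\top\Delta w\ge0.$$ It is itself an MPCC in $\Delta w$. Explicitly, a feasible point $\Delta w$ of the QPCC is S-stationary with associated multipliers $(\lambda,\mu,\xi,\nu)$ if, with $\hat g=g(w^k)+\nabla g(w^k)^\top\Delta w$, $\hat G=G(w^k)+\nabla G(w^k)^\top\Delta w$ and $\hat H=H(w^k)+\nabla H(w^k)^\top\Delta w$, it holds that $\nabla f(w^k)+M^k\Delta w+\nabla h(w^k)\lambda+\nabla g(w^k)\mu-\nabla G(w^k)\xi-\nabla H(w^k)\nu=0$, $0\le\mu\perp-\hat g\ge0$, $\nu_i=0$ for all $i$ with $\hat G_i=0$, $\hat H_i>0$, $\xi_i=0$ for all $i$ with $\hat G_i>0$,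 $\hat H_i=0$, and $\xi_i\ge0$, $\nu_i\ge0$ for all $i$ with $\hat G_i=\hat H_i=0$. A sequence of SQPCC iterates starting at $z^0$ is a sequence $z^k=(w^k,\lambda^k,\mu^k,\xi^k,\nu^k)$ such that for every $k\ge0$, $\Delta w^k=w^{k+1}-w^k$ is an S-stationary point of the QPCC at $z^k$ with associated multipliers $(\lambda^{k+1},\mu^{k+1},\xi^{k+1},\nu^{k+1})$. Perturbed branch NLPs: for $\mathcal{I}\in\mathcal{P}(\bar w)$ and $r=(r_f,r_h,r_g,r_G,r_H)$: minimize $f(w)-r_f^\top w$ subject to $h(w)-r_h=0$, $g(w)+r_g\le0$, $G_i(w)-r_{G,i}=0$ and $H_i(w)-r_{H,i}\ge0$ for $i\in\mathcal{I}$, $G_i(w)-r_{G,i}\ge0$ and $H_i(w)-r_{H,i}=0$ for $i\in\mathcal{I}^{\mathrm C}$. For $r$ near $0$ it has a locally unique continuous primal-dual solution map $z^{\mathcal{I}}(r)$ with $z^{\mathcal{I}}(0)=\bar z$; its Lipschitz constant $\gamma^{\mathcal{I}}$ is a constant with $\|z^{\mathcal{I}}(r)-\bar z\|\le\gamma^{\mathcal{I}}\|r\|$ for all $r$ sufficiently close to $0$.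
   Formalization: Conclusion (1) is stated only for non-S-stationary limits with w̃ within the radius around w̄ on which the additional assumption holds; for far-away limits, about which nothing is assumed, the claim fails. *)

theory Defs
  imports "HOL-Analysis.Analysis"
begin

definition gradient :: "(real^'n \<Rightarrow> real) \<Rightarrow> real^'n \<Rightarrow> real^'n" where
  "gradient \<phi> w = (\<chi> j. frechet_derivative \<phi> (at w) (axis j 1))"

definition hessian :: "(real^'n \<Rightarrow> real) \<Rightarrow> real^'n \<Rightarrow> real^'n^'n" where
  "hessian \<phi> w = jacobian (gradient \<phi>) (at w)"

text \<open>The gradient of a vector-valued function is the transpose of its Jacobian; its columns are
  the gradients of the components.\<close>

definition nabla :: "(real^'n \<Rightarrow> real^'k) \<Rightarrow> real^'n \<Rightarrow> real^'k^'n" where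
  "nabla F w = transpose (jacobian F (at w))"

definition twice_diff_near :: "(real^'n \<Rightarrow> real) \<Rightarrow> real^'n \<Rightarrow> bool" where
  "twice_diff_near \<phi> a \<longleftrightarrow>
     (\<forall>\<^sub>F w in nhds a. \<phi> differentiable (at w) \<and> gradient \<phi> differentiable (at w)) \<and>
     isCont (hessian \<phi>) a"

definition pos_def :: "real^'n^'n \<Rightarrow> bool" where
  "pos_def A \<longleftrightarrow> transpose A = A \<and> (\<forall>x. x \<noteq> 0 \<longrightarrow> 0 < x \<bullet> (A *v x))"

text \<open>The problem data of: minimize \<open>f w\<close> subject to \<open>h w = 0\<close>, \<open>g w \<le> 0\<close>,
  \<open>0 \<le> G w \<bottom> H w \<ge> 0\<close>.\<close>

record ('n::finite, 'h::finite, 'g::finite, 'm::finite) mpcc =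
  mpcc_f :: "real^'n \<Rightarrow> real"
  mpcc_h :: "real^'n \<Rightarrow> real^'h"
  mpcc_g :: "real^'n \<Rightarrow> real^'g"
  mpcc_G :: "real^'n \<Rightarrow> real^'m"
  mpcc_H :: "real^'n \<Rightarrow> real^'m"

text \<open>Primal-dual variables \<open>(w, \<lambda>, \<mu>, \<xi>, \<nu>)\<close>, with the Euclidean norm of the
  product. The perturbations \<open>(r_f, r_h, r_g, r_G, r_H)\<close> live in the same space.\<close>

type_synonym ('n, 'h, 'g, 'm) pdvar =
  "(real^'n) \<times> (real^'h) \<times> (real^'g) \<times> (real^'m) \<times> (real^'m)"

definition smooth_data ::
    "('n::finite, 'h::finite, 'g::finite, 'm::finite) mpcc \<Rightarrow>
     real^'n \<Rightarrow> bool" where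
  "smooth_data P a \<longleftrightarrow>
     twice_diff_near (mpcc_f P) a \<and>
     (\<forall>i. twice_diff_near (\<lambda>w. mpcc_h P w $ i) a) \<and>
     (\<forall>i. twice_diff_near (\<lambda>w. mpcc_g P w $ i) a) \<and>
     (\<forall>i. twice_diff_near (\<lambda>w. mpcc_G P w $ i) a) \<and>
     (\<forall>i. twice_diff_near (\<lambda>w. mpcc_H P w $ i) a)"

definition feasible ::
    "('n::finite, 'h::finite, 'g::finite, 'm::finite) mpcc \<Rightarrow>
     real^'n \<Rightarrow> bool" where
  "feasible P w \<longleftrightarrow>
     mpcc_h P w = 0 \<and> (\<forall>i. mpcc_g P w $ i \<le> 0) \<and>
     (\<forall>i. 0 \<le> mpcc_G P w $ i \<and> 0 \<le> mpcc_H P w $ i \<and> mpcc_G P w $ i * mpcc_H P w $ i = 0)"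

definition local_solution ::
    "('n::finite, 'h::finite, 'g::finite, 'm::finite) mpcc \<Rightarrow>
     real^'n \<Rightarrow> bool" where
  "local_solution P w \<longleftrightarrow>
     feasible P w \<and> (\<exists>\<rho>>0. \<forall>v. feasible P v \<and> dist v w < \<rho> \<longrightarrow> mpcc_f P w \<le> mpcc_f P v)"

definition act ::
    "('n::finite, 'h::finite, 'g::finite, 'm::finite) mpcc \<Rightarrow>
     real^'n \<Rightarrow> 'g set" where
  "act P w = {i. mpcc_g P w $ i = 0}"

definition act_pos ::
    "('n::finite, 'h::finite, 'g::finite, 'm::finite) mpcc \<Rightarrow>
     real^'n \<Rightarrow> real^'g \<Rightarrow> 'g set" where
  "act_pos P w \<mu> = {i \<in> act P w. \<mu> $ i > 0}"

definition I0p ::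
    "('n::finite, 'h::finite, 'g::finite, 'm::finite) mpcc \<Rightarrow>
     real^'n \<Rightarrow> 'm set" where
  "I0p P w = {i. mpcc_G P w $ i = 0 \<and> mpcc_H P w $ i > 0}"

definition Ip0 ::
    "('n::finite, 'h::finite, 'g::finite, 'm::finite) mpcc \<Rightarrow>
     real^'n \<Rightarrow> 'm set" where
  "Ip0 P w = {i. mpcc_G P w $ i > 0 \<and> mpcc_H P w $ i = 0}"

definition I00 ::
    "('n::finite, 'h::finite, 'g::finite, 'm::finite) mpcc \<Rightarrow>
     real^'n \<Rightarrow> 'm set" where
  "I00 P w = {i. mpcc_G P w $ i = 0 \<and> mpcc_H P w $ i = 0}"

definition partitions ::
    "('n::finite, 'h::finite, 'g::finite, 'm::finite) mpcc \<Rightarrow>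
     real^'n \<Rightarrow> 'm set set" where
  "partitions P w = {I0p P w \<union> J | J. J \<subseteq> I00 P w}"

fun lagrangian ::
    "('n::finite, 'h::finite, 'g::finite, 'm::finite) mpcc \<Rightarrow>
     ('n, 'h, 'g, 'm) pdvar \<Rightarrow> real" where
  "lagrangian P (w, la, \<mu>, \<xi>, \<nu>) =
     mpcc_f P w + la \<bullet> mpcc_h P w + \<mu> \<bullet> mpcc_g P w - \<xi> \<bullet> mpcc_G P w - \<nu> \<bullet> mpcc_H P w"

fun grad_lagrangian ::
    "('n::finite, 'h::finite, 'g::finite, 'm::finite) mpcc \<Rightarrow>
     ('n, 'h, 'g, 'm) pdvar \<Rightarrow> real^'n" where
  "grad_lagrangian P (w, y) = gradient (\<lambda>v. lagrangian P (v, y)) w"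

fun hess_lagrangian ::
    "('n::finite, 'h::finite, 'g::finite, 'm::finite) mpcc \<Rightarrow>
     ('n, 'h, 'g, 'm) pdvar \<Rightarrow> real^'n^'n" where
  "hess_lagrangian P (w, y) = hessian (\<lambda>v. lagrangian P (v, y)) w"

fun W_stationary ::
    "('n::finite, 'h::finite, 'g::finite, 'm::finite) mpcc \<Rightarrow>
     ('n, 'h, 'g, 'm) pdvar \<Rightarrow> bool" where
  "W_stationary P (w, la, \<mu>, \<xi>, \<nu>) \<longleftrightarrow>
     feasible P w \<and>
     grad_lagrangian P (w, la, \<mu>, \<xi>, \<nu>) = 0 \<and>
     (\<forall>i. 0 \<le> \<mu> $ i \<and> 0 \<le> - mpcc_g P w $ i \<and> \<mu> $ i * mpcc_g P w $ i = 0) \<and>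
     (\<forall>i\<in>I0p P w. \<nu> $ i = 0) \<and>
     (\<forall>i\<in>Ip0 P w. \<xi> $ i = 0)"

fun S_stationary ::
    "('n::finite, 'h::finite, 'g::finite, 'm::finite) mpcc \<Rightarrow>
     ('n, 'h, 'g, 'm) pdvar \<Rightarrow> bool" where
  "S_stationary P (w, la, \<mu>, \<xi>, \<nu>) \<longleftrightarrow>
     W_stationary P (w, la, \<mu>, \<xi>, \<nu>) \<and> (\<forall>i\<in>I00 P w. 0 \<le> \<xi> $ i \<and> 0 \<le> \<nu> $ i)"

definition non_S_stationary ::
    "('n::finite, 'h::finite, 'g::finite, 'm::finite) mpcc \<Rightarrow>
     ('n, 'h, 'g, 'm) pdvar \<Rightarrow> bool" where
  "non_S_stationary P z \<longleftrightarrow> W_stationary P z \<and> \<not> S_stationary P z"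

text \<open>Linear independence of an indexed family: the family is injective on the active indices and
  its range is an independent set. The index type is the disjoint sum of the constraint indices
  for \<open>h\<close>, \<open>g\<close>, \<open>G\<close>, \<open>H\<close>, in this order.\<close>

definition constraint_gradient ::
    "('n::finite, 'h::finite, 'g::finite, 'm::finite) mpcc \<Rightarrow>
     real^'n \<Rightarrow> 'h + 'g + 'm + 'm \<Rightarrow> real^'n" where
  "constraint_gradient P w =
     case_sum (\<lambda>i. gradient (\<lambda>v. mpcc_h P v $ i) w)
    (case_sum (\<lambda>i. gradient (\<lambda>v. mpcc_g P v $ i) w)
    (case_sum (\<lambda>i. gradient (\<lambda>v. mpcc_G P v $ i) w)
              (\<lambda>i. gradient (\<lambda>v. mpcc_H P v $ i) w)))"

definition mpcc_LICQ ::
    "('n::finite, 'h::finite, 'g::finite, 'm::finite) mpcc \<Rightarrow>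
     real^'n \<Rightarrow> bool" where
  "mpcc_LICQ P w \<longleftrightarrow>
     (let A = UNIV <+> (act P w <+> ((I0p P w \<union> I00 P w) <+> (Ip0 P w \<union> I00 P w)))
      in inj_on (constraint_gradient P w) A \<and> independent (constraint_gradient P w ` A))"

fun critical_directions ::
    "('n::finite, 'h::finite, 'g::finite, 'm::finite) mpcc \<Rightarrow>
     ('n, 'h, 'g, 'm) pdvar \<Rightarrow> 'm set \<Rightarrow> (real^'n) set" where
  "critical_directions P (w, la, \<mu>, \<xi>, \<nu>) I =
     {d. (\<forall>i. gradient (\<lambda>v. mpcc_h P v $ i) w \<bullet> d = 0) \<and>
         (\<forall>i\<in>act_pos P w \<mu>. gradient (\<lambda>v. mpcc_g P v $ i) w \<bullet> d = 0) \<and>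
         (\<forall>i\<in>I \<union> {j \<in> - I. \<xi> $ j > 0}. gradient (\<lambda>v. mpcc_G P v $ i) w \<bullet> d = 0) \<and>
         (\<forall>i\<in>- I \<union> {j \<in> I. \<nu> $ j > 0}. gradient (\<lambda>v. mpcc_H P v $ i) w \<bullet> d = 0)}"

definition mpcc_SSOSC ::
    "('n::finite, 'h::finite, 'g::finite, 'm::finite) mpcc \<Rightarrow>
     ('n, 'h, 'g, 'm) pdvar \<Rightarrow> bool" where
  "mpcc_SSOSC P z \<longleftrightarrow>
     S_stationary P z \<and>
     (\<forall>d \<in> (\<Union>I\<in>partitions P (fst z). critical_directions P z I).
        d \<noteq> 0 \<longrightarrow> 0 < d \<bullet> (hess_lagrangian P z *v d))"

fun Psi ::
    "('n::finite, 'h::finite, 'g::finite, 'm::finite) mpcc \<Rightarrow>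
     ('n, 'h, 'g, 'm) pdvar \<Rightarrow> ('n, 'h, 'g, 'm) pdvar" where
  "Psi P (w, y) =
     (grad_lagrangian P (w, y), mpcc_h P w, - mpcc_g P w, mpcc_G P w, mpcc_H P w)"

text \<open>The Jacobian of \<open>\<Psi>\<close> as a linear map, and the map obtained from it by replacing the Hessian
  of the Lagrangian, its \<open>(w, w)\<close> block, by \<open>M\<close>.\<close>

definition Psi_jac ::
    "('n::finite, 'h::finite, 'g::finite, 'm::finite) mpcc \<Rightarrow>
     ('n, 'h, 'g, 'm) pdvar \<Rightarrow>
     ('n, 'h, 'g, 'm) pdvar \<Rightarrow> ('n, 'h, 'g, 'm) pdvar" where
  "Psi_jac P z = frechet_derivative (Psi P) (at z)"

definition Psi_jac_approx ::
    "('n::finite, 'h::finite, 'g::finite, 'm::finite) mpcc \<Rightarrow>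
     real^'n^'n \<Rightarrow> ('n, 'h, 'g, 'm) pdvar \<Rightarrow>
     ('n, 'h, 'g, 'm) pdvar \<Rightarrow> ('n, 'h, 'g, 'm) pdvar" where
  "Psi_jac_approx P M z dz =
     Psi_jac P z dz + ((M - hess_lagrangian P z) *v fst dz, 0)"

text \<open>\<open>dw\<close> is an S-stationary point of the QPCC at \<open>w\<close> with Hessian approximation \<open>M\<close>, with
  multipliers \<open>(\<lambda>, \<mu>, \<xi>, \<nu>)\<close>.\<close>

fun qpcc_S_stationary ::
    "('n::finite, 'h::finite, 'g::finite, 'm::finite) mpcc \<Rightarrow>
     real^'n \<Rightarrow> real^'n^'n \<Rightarrow> ('n, 'h, 'g, 'm) pdvar \<Rightarrow> bool" where
  "qpcc_S_stationary P w M (dw, la, \<mu>, \<xi>, \<nu>) \<longleftrightarrow>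
     (let h' = mpcc_h P w + transpose (nabla (mpcc_h P) w) *v dw;
          g' = mpcc_g P w + transpose (nabla (mpcc_g P) w) *v dw;
          G' = mpcc_G P w + transpose (nabla (mpcc_G P) w) *v dw;
          H' = mpcc_H P w + transpose (nabla (mpcc_H P) w) *v dw
      in h' = 0 \<and>
         (\<forall>i. g' $ i \<le> 0) \<and>
         (\<forall>i. 0 \<le> G' $ i \<and> 0 \<le> H' $ i \<and> G' $ i * H' $ i = 0) \<and>
         gradient (mpcc_f P) w + M *v dw
           + nabla (mpcc_h P) w *v la + nabla (mpcc_g P) w *v \<mu>
           - nabla (mpcc_G P) w *v \<xi> - nabla (mpcc_H P) w *v \<nu> = 0 \<and>
         (\<forall>i. 0 \<le> \<mu> $ i \<and> 0 \<le> - g' $ i \<and> \<mu> $ i * g' $ i = 0) \<and>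
         (\<forall>i. G' $ i = 0 \<and> H' $ i > 0 \<longrightarrow> \<nu> $ i = 0) \<and>
         (\<forall>i. G' $ i > 0 \<and> H' $ i = 0 \<longrightarrow> \<xi> $ i = 0) \<and>
         (\<forall>i. G' $ i = 0 \<and> H' $ i = 0 \<longrightarrow> 0 \<le> \<xi> $ i \<and> 0 \<le> \<nu> $ i))"

text \<open>\<open>M k z\<close> is the Hessian approximation used in iteration \<open>k\<close> if the current iterate is \<open>z\<close>.\<close>

definition sqpcc_iterates ::
    "('n::finite, 'h::finite, 'g::finite, 'm::finite) mpcc \<Rightarrow>
     (nat \<Rightarrow> ('n, 'h, 'g, 'm) pdvar \<Rightarrow> real^'n^'n) \<Rightarrow>
     (nat \<Rightarrow> ('n, 'h, 'g, 'm) pdvar) \<Rightarrow> bool" where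
  "sqpcc_iterates P M z \<longleftrightarrow>
     (\<forall>k. qpcc_S_stationary P (fst (z k)) (M k (z k))
            (fst (z (Suc k)) - fst (z k), snd (z (Suc k))))"

text \<open>Primal-dual solutions (KKT points) of: minimize \<open>f w - r_f \<bullet> w\<close> subject to
  \<open>h w - r_h = 0\<close>, \<open>g w + r_g \<le> 0\<close>, \<open>G\<^sub>i w - r_G\<^sub>i = 0\<close> and \<open>H\<^sub>i w - r_H\<^sub>i \<ge> 0\<close> for \<open>i \<in> I\<close>,
  \<open>G\<^sub>i w - r_G\<^sub>i \<ge> 0\<close> and \<open>H\<^sub>i w - r_H\<^sub>i = 0\<close> for \<open>i \<notin> I\<close>. The gradient of the Lagrangian of this
  problem is that of the unperturbed Lagrangian minus \<open>r_f\<close>.\<close>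

fun branch_KKT ::
    "('n::finite, 'h::finite, 'g::finite, 'm::finite) mpcc \<Rightarrow>
     'm set \<Rightarrow> ('n, 'h, 'g, 'm) pdvar \<Rightarrow> ('n, 'h, 'g, 'm) pdvar \<Rightarrow> bool"
  where
  "branch_KKT P I (rf, rh, rg, rG, rH) (w, la, \<mu>, \<xi>, \<nu>) \<longleftrightarrow>
     grad_lagrangian P (w, la, \<mu>, \<xi>, \<nu>) - rf = 0 \<and>
     mpcc_h P w - rh = 0 \<and>
     (\<forall>i. mpcc_g P w $ i + rg $ i \<le> 0 \<and> 0 \<le> \<mu> $ i \<and> \<mu> $ i * (mpcc_g P w $ i + rg $ i) = 0) \<and>
     (\<forall>i\<in>I. mpcc_G P w $ i - rG $ i = 0 \<and>
        0 \<le> mpcc_H P w $ i - rH $ i \<and> 0 \<le> \<nu> $ i \<and> \<nu> $ i * (mpcc_H P w $ i - rH $ i) = 0) \<and>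
     (\<forall>i\<in>- I. mpcc_H P w $ i - rH $ i = 0 \<and>
        0 \<le> mpcc_G P w $ i - rG $ i \<and> 0 \<le> \<xi> $ i \<and> \<xi> $ i * (mpcc_G P w $ i - rG $ i) = 0)"

definition branch_solution_map ::
    "('n::finite, 'h::finite, 'g::finite, 'm::finite) mpcc \<Rightarrow>
     ('n, 'h, 'g, 'm) pdvar \<Rightarrow> 'm set \<Rightarrow>
     (('n, 'h, 'g, 'm) pdvar \<Rightarrow> ('n, 'h, 'g, 'm) pdvar) \<Rightarrow> bool" where
  "branch_solution_map P zbar I s \<longleftrightarrow>
     s 0 = zbar \<and>
     (\<exists>\<rho>>0. \<exists>N. open N \<and> zbar \<in> N \<and> continuous_on (ball 0 \<rho>) s \<and>
        (\<forall>r\<in>ball 0 \<rho>. {z \<in> N. branch_KKT P I r z} = {s r}))"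

text \<open>The estimate compares \<open>s r\<close> only with \<open>s 0 = zbar\<close>, and the constant need not be the smallest
  one.\<close>

definition branch_Lipschitz_constant ::
    "('n::finite, 'h::finite, 'g::finite, 'm::finite) mpcc \<Rightarrow>
     ('n, 'h, 'g, 'm) pdvar \<Rightarrow> 'm set \<Rightarrow> real \<Rightarrow> bool" where
  "branch_Lipschitz_constant P zbar I c \<longleftrightarrow>
     (\<exists>s. branch_solution_map P zbar I s \<and> (\<forall>\<^sub>F r in nhds 0. norm (s r - zbar) \<le> c * norm r))"

text \<open>Q-superlinear and Q-quadratic convergence, in a form that allows the limit to be reached.\<close>

definition superlinearly_converges ::
    "(nat \<Rightarrow> 'a::metric_space) \<Rightarrow> 'a \<Rightarrow> bool" where
  "superlinearly_converges z l \<longleftrightarrow>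
     z \<longlonglongrightarrow> l \<and> (\<exists>c. c \<longlonglongrightarrow> 0 \<and> (\<forall>k. dist (z (Suc k)) l \<le> c k * dist (z k) l))"

definition quadratically_converges ::
    "(nat \<Rightarrow> 'a::metric_space) \<Rightarrow> 'a \<Rightarrow> bool" where
  "quadratically_converges z l \<longleftrightarrow>
     z \<longlonglongrightarrow> l \<and> (\<exists>c. \<forall>k. dist (z (Suc k)) l \<le> c * (dist (z k) l)\<^sup>2)"

end

(*
  If z+ and z lie near zbar and z+ solves the QPCC at z, then z+ is a KKT point of one of the branch
  NLPs perturbed by r = Psi(z+) - Psi(z) - Psi~'(z)(z+ - z). Hence |z+ - zbar| <= gamma |r|, and as
  |r| <= kappa |z+ - z| + omega |z+ - z|^2, this gives the rate and (2).

  For the existence of steps, Brouwer's theorem applied to z+ |-> s(r(z+)), with s the solution map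
  of a branch NLP, yields a KKT point of every branch of the QPCC near zbar. The one with the least
  objective value is S-stationary for the QPCC: moving a biactive index to the other side of the
  partition leaves it feasible, so by strict convexity the switched branch has the same minimizer,
  and by LICQ the same multipliers; hence both signs at a biactive index are right.

  For (1), a limit with xi_i < 0 or nu_i < 0, both nonzero, at a biactive index violates the sign
  conditions of the QPCC for all late iterates.
*)
theory Submission
  imports Defs
begin

text \<open>Brouwer's theorem is used instead of the contraction principle because
  \<open>branch_Lipschitz_constant\<close> compares \<open>s r\<close> only with
  \<open>zbar\<close>. Nothing bounds the distance between two values of \<open>s\<close>, so the
  map z+ |-> s(r(z+)) is continuous but not known to contract. As z+ occurs on both sides, |z+ -
  zbar| \<le> \<gamma> |r| is an implicit inequality. The bound \<gamma> \<kappa> < 1/3 and a radius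
  \<epsilon> with 4 \<gamma> \<omega> \<epsilon> \<le> 1/4 serve twice: the fixed point map sends
  the closed \<epsilon>-ball into itself, with factor at most 2/3 + 1/4 = 11/12, and less than half
  of |z+ - zbar| is left on the right, which gives the rate with \<alpha> = 2 \<gamma> \<kappa> and
  \<beta> = 4 \<gamma> \<omega>. The branch solved by a step is not known in advance and may change
  from step to step, hence the maximum \<gamma> over all branches. The fixed point need not be
  unique, so the estimates are proved for every step inside the ball; staying inside is shown for
  the constructed steps and is a hypothesis in (2).\<close>

section \<open>The Jacobian of the Karush-Kuhn-Tucker map\<close>

declare lagrangian.simps [simp del] grad_lagrangian.simps [simp del] hess_lagrangian.simps [simp del]

lemma frechet_derivative_eq_gradient:
  assumes "\<phi> differentiable (at w)"
  shows "frechet_derivative \<phi> (at w) d = gradient \<phi> w \<bullet> d"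
proof -
  interpret linear "frechet_derivative \<phi> (at w)"
    by (rule linear_frechet_derivative[OF assms])
  have "frechet_derivative \<phi> (at w) d =
      frechet_derivative \<phi> (at w) (\<Sum>j\<in>UNIV. d $ j *s axis j 1)"
    by (simp add: basis_expansion)
  also have "\<dots> = gradient \<phi> w \<bullet> d"
    by (simp add: sum scale scalar_mult_eq_scaleR gradient_def inner_vec_def mult.commute)
  finally show ?thesis .
qed

lemma has_derivative_gradient:
  assumes "\<phi> differentiable (at w)"
  shows "(\<phi> has_derivative (\<lambda>d. gradient \<phi> w \<bullet> d)) (at w)"
proof -
  have "frechet_derivative \<phi> (at w) = (\<lambda>d. gradient \<phi> w \<bullet> d)"
    using assms by (simp add: frechet_derivative_eq_gradient fun_eq_iff)
  then show ?thesis
    using assms frechet_derivative_works[of \<phi> "at w"] by simp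
qed

lemma gradient_eqI:
  assumes "(\<phi> has_derivative (\<lambda>d. a \<bullet> d)) (at w)"
  shows "gradient \<phi> w = a"
proof -
  have "frechet_derivative \<phi> (at w) = (\<lambda>d. a \<bullet> d)"
    using assms frechet_derivative_at by metis
  then show ?thesis
    by (simp add: gradient_def vec_eq_iff inner_axis)
qed

lemma has_derivative_vec_lambda:
  fixes F :: "'a::real_normed_vector \<Rightarrow> real^'k"
  assumes "\<And>i. ((\<lambda>v. F v $ i) has_derivative (\<lambda>d. F' d $ i)) (at w)"
  shows "(F has_derivative F') (at w)"
proof -
  have "((\<lambda>v. F v \<bullet> b) has_derivative (\<lambda>d. F' d \<bullet> b)) (at w)" if "b \<in> Basis" for b
    using that assms by (auto simp: Basis_vec_def inner_axis)
  then show ?thesis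
    by (subst has_derivative_componentwise_within) auto
qed

text \<open>The QPCC is written with the matrix \<open>nabla F w\<close>, LICQ with the gradients of
  the components. These facts translate between the two.\<close>

lemma
  fixes F :: "real^'n \<Rightarrow> real^'k"
  assumes "\<And>i. (\<lambda>v. F v $ i) differentiable (at w)"
  shows transpose_nabla_mult_component: "(transpose (nabla F w) *v d) $ i = gradient (\<lambda>v. F v $ i) w \<bullet> d"
    and has_derivative_nabla: "(F has_derivative (\<lambda>d. transpose (nabla F w) *v d)) (at w)"
    and nabla_mult: "nabla F w *v y = (\<Sum>i\<in>UNIV. y $ i *\<^sub>R gradient (\<lambda>v. F v $ i) w)"
proof -
  define F' where "F' = (\<lambda>d. \<chi> i. gradient (\<lambda>v. F v $ i) w \<bullet> d)"
  have F': "(F has_derivative F') (at w)"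
    by (rule has_derivative_vec_lambda) (simp add: F'_def has_derivative_gradient assms)
  then have D: "frechet_derivative F (at w) = F'"
    using frechet_derivative_at by metis
  have lin: "linear F'"
    using F' has_derivative_linear by blast
  have 1: "transpose (nabla F w) *v d = F' d" for d
    using lin by (simp add: nabla_def transpose_transpose jacobian_def D)
  then show "(transpose (nabla F w) *v d) $ i = gradient (\<lambda>v. F v $ i) w \<bullet> d"
    by (simp add: F'_def)
  show "(F has_derivative (\<lambda>d. transpose (nabla F w) *v d)) (at w)"
    using F' unfolding 1 .
  have "nabla F w $ j $ i = gradient (\<lambda>v. F v $ i) w $ j" for i j
    by (simp add: nabla_def jacobian_def D transpose_def matrix_def F'_def inner_axis)
  then show "nabla F w *v y = (\<Sum>i\<in>UNIV. y $ i *\<^sub>R gradient (\<lambda>v. F v $ i) w)"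
    by (simp add: vec_eq_iff matrix_vector_mult_def mult.commute)
qed

text \<open>The pointwise part of \<open>twice_diff_near\<close>. Listing the scalar functions as
  one finite set lets a single finite intersection of neighbourhoods serve all of them.\<close>

definition smooth_at ::
    "('n::finite, 'h::finite, 'g::finite, 'm::finite) mpcc \<Rightarrow> real^'n \<Rightarrow> bool" where
  "smooth_at P w \<longleftrightarrow>
     (\<forall>\<phi> \<in> insert (mpcc_f P) (range (\<lambda>i v. mpcc_h P v $ i) \<union> range (\<lambda>i v. mpcc_g P v $ i) \<union>
        range (\<lambda>i v. mpcc_G P v $ i) \<union> range (\<lambda>i v. mpcc_H P v $ i)).
        \<phi> differentiable (at w) \<and> gradient \<phi> differentiable (at w))"

lemma eventually_smooth_at:
  assumes "smooth_data P a"
  shows "\<forall>\<^sub>F w in nhds a. smooth_at P w"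
proof -
  have "\<forall>\<^sub>F w in nhds a. \<forall>\<phi> \<in> insert (mpcc_f P)
        (range (\<lambda>i v. mpcc_h P v $ i) \<union> range (\<lambda>i v. mpcc_g P v $ i) \<union>
        range (\<lambda>i v. mpcc_G P v $ i) \<union> range (\<lambda>i v. mpcc_H P v $ i)).
        \<phi> differentiable (at w) \<and> gradient \<phi> differentiable (at w)"
    by (rule eventually_ball_finite) (use assms in \<open>auto simp: smooth_data_def twice_diff_near_def\<close>)
  then show ?thesis
    by (simp only: smooth_at_def)
qed

lemma matrix_mult_inner_eq:
  fixes A :: "real^'k^'n"
  shows "(A *v y) \<bullet> e = y \<bullet> (transpose A *v e)"
  by (simp add: dot_lmul_matrix transpose_matrix_vector flip: vector_transpose_matrix)

lemma has_derivative_inner_nabla: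
  fixes F :: "real^'n \<Rightarrow> real^'k"
  assumes "\<And>i. (\<lambda>v. F v $ i) differentiable (at w)"
  shows "((\<lambda>v. y \<bullet> F v) has_derivative (\<lambda>d. (nabla F w *v y) \<bullet> d)) (at w)"
proof -
  have "((\<lambda>v. y \<bullet> F v) has_derivative (\<lambda>d. y \<bullet> (transpose (nabla F w) *v d))) (at w)"
    by (intro derivative_intros has_derivative_nabla assms)
  then show ?thesis
    by (simp only: matrix_mult_inner_eq)
qed

lemma grad_lagrangian_eq:
  assumes "smooth_at P w"
  shows "grad_lagrangian P (w, la, \<mu>, \<xi>, \<nu>) =
    gradient (mpcc_f P) w + nabla (mpcc_h P) w *v la + nabla (mpcc_g P) w *v \<mu>
      - nabla (mpcc_G P) w *v \<xi> - nabla (mpcc_H P) w *v \<nu>"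
proof -
  have "((\<lambda>v. lagrangian P (v, la, \<mu>, \<xi>, \<nu>)) has_derivative (\<lambda>d.
      gradient (mpcc_f P) w \<bullet> d + (nabla (mpcc_h P) w *v la) \<bullet> d + (nabla (mpcc_g P) w *v \<mu>) \<bullet> d
      - (nabla (mpcc_G P) w *v \<xi>) \<bullet> d - (nabla (mpcc_H P) w *v \<nu>) \<bullet> d)) (at w)"
    unfolding lagrangian.simps using assms
    by (intro has_derivative_add has_derivative_diff has_derivative_gradient
          has_derivative_inner_nabla) (auto simp: smooth_at_def)
  then show ?thesis
    unfolding grad_lagrangian.simps by (intro gradient_eqI) (simp add: algebra_simps)
qed

text \<open>Joint differentiability in all variables comes first, from the sum formula for the
  gradient. The derivative is then identified on two slices: with fixed multipliers it is the
  Hessian, with fixed \<open>w\<close> the map is affine; additivity puts them together. Smoothness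
  is assumed near \<open>w\<close> because the sum formula must hold on an open set before it can be
  differentiated.\<close>

lemma has_derivative_grad_lagrangian:
  fixes P :: "('n::finite, 'h::finite, 'g::finite, 'm::finite) mpcc"
  assumes "\<forall>\<^sub>F v in nhds w. smooth_at P v"
  shows "(grad_lagrangian P has_derivative
      (\<lambda>(dw, dla, d\<mu>, d\<xi>, d\<nu>). hess_lagrangian P (w, la, \<mu>, \<xi>, \<nu>) *v dw + nabla (mpcc_h P) w *v dla
        + nabla (mpcc_g P) w *v d\<mu> - nabla (mpcc_G P) w *v d\<xi> - nabla (mpcc_H P) w *v d\<nu>))
      (at (w, la, \<mu>, \<xi>, \<nu>))"
proof -
  have sm: "smooth_at P w"
    using assms eventually_nhds_x_imp_x by blast
  have "\<forall>\<^sub>F v in nhds w. \<forall>y. grad_lagrangian P (v, y) = gradient (mpcc_f P) v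
      + (\<Sum>i\<in>UNIV. fst y $ i *\<^sub>R gradient (\<lambda>v. mpcc_h P v $ i) v)
      + (\<Sum>i\<in>UNIV. fst (snd y) $ i *\<^sub>R gradient (\<lambda>v. mpcc_g P v $ i) v)
      - (\<Sum>i\<in>UNIV. fst (snd (snd y)) $ i *\<^sub>R gradient (\<lambda>v. mpcc_G P v $ i) v)
      - (\<Sum>i\<in>UNIV. snd (snd (snd y)) $ i *\<^sub>R gradient (\<lambda>v. mpcc_H P v $ i) v)"
    using assms
  proof eventually_elim
    case (elim v)
    then have "nabla (mpcc_h P) v *v y = (\<Sum>i\<in>UNIV. y $ i *\<^sub>R gradient (\<lambda>v. mpcc_h P v $ i) v)"
      "nabla (mpcc_g P) v *v y' = (\<Sum>i\<in>UNIV. y' $ i *\<^sub>R gradient (\<lambda>v. mpcc_g P v $ i) v)"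
      "nabla (mpcc_G P) v *v y'' = (\<Sum>i\<in>UNIV. y'' $ i *\<^sub>R gradient (\<lambda>v. mpcc_G P v $ i) v)"
      "nabla (mpcc_H P) v *v y'' = (\<Sum>i\<in>UNIV. y'' $ i *\<^sub>R gradient (\<lambda>v. mpcc_H P v $ i) v)"
      for y y' y''
      by (simp_all add: nabla_mult smooth_at_def)
    then show ?case
      by (auto simp: grad_lagrangian_eq[OF elim])
  qed
  then obtain W where W: "open W" "w \<in> W" and K: "\<And>z. z \<in> W \<times> UNIV \<Longrightarrow>
      grad_lagrangian P z = gradient (mpcc_f P) (fst z)
      + (\<Sum>i\<in>UNIV. fst (snd z) $ i *\<^sub>R gradient (\<lambda>v. mpcc_h P v $ i) (fst z))
      + (\<Sum>i\<in>UNIV. fst (snd (snd z)) $ i *\<^sub>R gradient (\<lambda>v. mpcc_g P v $ i) (fst z))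
      - (\<Sum>i\<in>UNIV. fst (snd (snd (snd z))) $ i *\<^sub>R gradient (\<lambda>v. mpcc_G P v $ i) (fst z))
      - (\<Sum>i\<in>UNIV. snd (snd (snd (snd z))) $ i *\<^sub>R gradient (\<lambda>v. mpcc_H P v $ i) (fst z))"
      (is "\<And>z. _ \<Longrightarrow> _ = ?K z")
    unfolding eventually_nhds by fastforce
  let ?z = "(w, la, \<mu>, \<xi>, \<nu>)"
  have fst_diff: "(\<lambda>z. \<psi> (fst z)) differentiable (at ?z)" if "\<psi> differentiable (at w)"
    for \<psi> :: "real^'n \<Rightarrow> real^'n"
    by (rule differentiable_compose[where g = fst])
       (use that in \<open>auto intro: linear_imp_differentiable linear_fst\<close>)
  have comp_diff: "(\<lambda>z. L z $ i) differentiable F" if "bounded_linear L"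
    for L :: "('n, 'h, 'g, 'm) pdvar \<Rightarrow> real^'k::finite" and i F
    using bounded_linear_compose[OF bounded_linear_vec_nth that]
    by (rule bounded_linear_imp_differentiable)
  have "?K differentiable (at ?z)"
    by (intro differentiable_add differentiable_diff differentiable_sum ballI finite differentiable_scaleR
          fst_diff comp_diff bounded_linear_fst_comp bounded_linear_snd_comp bounded_linear_ident)
       (use sm in \<open>auto simp: smooth_at_def\<close>)
  then have "(?K has_derivative frechet_derivative ?K (at ?z)) (at ?z)"
    by (simp add: frechet_derivative_works)
  then have "(grad_lagrangian P has_derivative frechet_derivative ?K (at ?z)) (at ?z)"
    by (rule has_derivative_transform_within_open[where s = "W \<times> UNIV"])
       (use W K in \<open>auto simp: open_Times\<close>)
  then obtain D where D: "(grad_lagrangian P has_derivative D) (at ?z)"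
    by blast
  interpret D: linear D
    using D by (rule has_derivative_linear)
  have "((\<lambda>v. grad_lagrangian P (v, la, \<mu>, \<xi>, \<nu>)) has_derivative (\<lambda>d. D (d, 0))) (at w)"
    by (rule has_derivative_compose[where f = "\<lambda>v. (v, la, \<mu>, \<xi>, \<nu>)", OF _ D])
       (auto intro!: derivative_eq_intros simp: zero_prod_def)
  moreover from this have "((\<lambda>v. grad_lagrangian P (v, la, \<mu>, \<xi>, \<nu>)) has_derivative
      (\<lambda>d. hess_lagrangian P ?z *v d)) (at w)"
    by (simp add: hessian_def hess_lagrangian.simps grad_lagrangian.simps[abs_def]
          flip: jacobian_works) (auto simp: differentiable_def)
  ultimately have "(\<lambda>d. D (d, 0)) = (\<lambda>d. hess_lagrangian P ?z *v d)"
    by (rule has_derivative_unique)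
  then have 1: "D (d, 0) = hess_lagrangian P ?z *v d" for d
    by metis
  have "((\<lambda>y. grad_lagrangian P (w, y)) has_derivative (\<lambda>d. D (0, d))) (at (la, \<mu>, \<xi>, \<nu>))"
    by (rule has_derivative_compose[where f = "\<lambda>y. (w, y)", OF _ D])
       (auto intro!: derivative_eq_intros)
  moreover have "((\<lambda>y. grad_lagrangian P (w, y)) has_derivative (\<lambda>(dla, d\<mu>, d\<xi>, d\<nu>).
      nabla (mpcc_h P) w *v dla + nabla (mpcc_g P) w *v d\<mu>
      - nabla (mpcc_G P) w *v d\<xi> - nabla (mpcc_H P) w *v d\<nu>)) (at (la, \<mu>, \<xi>, \<nu>))"
  proof -
    note mv = bounded_linear.has_derivative[OF matrix_vector_mul_bounded_linear]
    have "(\<lambda>y. grad_lagrangian P (w, y)) = (\<lambda>y. gradient (mpcc_f P) w + nabla (mpcc_h P) w *v fst y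
        + nabla (mpcc_g P) w *v fst (snd y) - nabla (mpcc_G P) w *v fst (snd (snd y))
        - nabla (mpcc_H P) w *v snd (snd (snd y)))"
      by (auto simp: grad_lagrangian_eq[OF sm])
    then show ?thesis
      unfolding split_def by (auto intro!: derivative_eq_intros mv)
  qed
  ultimately have "(\<lambda>d. D (0, d)) = (\<lambda>(dla, d\<mu>, d\<xi>, d\<nu>).
      nabla (mpcc_h P) w *v dla + nabla (mpcc_g P) w *v d\<mu>
      - nabla (mpcc_G P) w *v d\<xi> - nabla (mpcc_H P) w *v d\<nu>)"
    by (rule has_derivative_unique)
  then have 2: "D (0, dla, d\<mu>, d\<xi>, d\<nu>) = nabla (mpcc_h P) w *v dla + nabla (mpcc_g P) w *v d\<mu>
      - nabla (mpcc_G P) w *v d\<xi> - nabla (mpcc_H P) w *v d\<nu>" for dla d\<mu> d\<xi> d\<nu>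
    by (auto simp: fun_eq_iff)
  have 3: "D (dw, dy) = D (dw, 0) + D (0, dy)" for dw dy
    using D.add[of "(dw, 0)" "(0, dy)"] by simp
  have "D (dw, dla, d\<mu>, d\<xi>, d\<nu>) = hess_lagrangian P ?z *v dw + nabla (mpcc_h P) w *v dla
      + nabla (mpcc_g P) w *v d\<mu> - nabla (mpcc_G P) w *v d\<xi> - nabla (mpcc_H P) w *v d\<nu>"
    for dw dla d\<mu> d\<xi> d\<nu>
    by (subst 3) (simp add: 1 2 algebra_simps)
  then have "D = (\<lambda>(dw, dla, d\<mu>, d\<xi>, d\<nu>). hess_lagrangian P ?z *v dw + nabla (mpcc_h P) w *v dla
        + nabla (mpcc_g P) w *v d\<mu> - nabla (mpcc_G P) w *v d\<xi> - nabla (mpcc_H P) w *v d\<nu>)"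
    by (simp add: fun_eq_iff)
  then show ?thesis
    using D by simp
qed

lemma has_derivative_Psi:
  fixes P :: "('n::finite, 'h::finite, 'g::finite, 'm::finite) mpcc"
  assumes "\<forall>\<^sub>F v in nhds w. smooth_at P v"
  shows "(Psi P has_derivative
      (\<lambda>(dw, dla, d\<mu>, d\<xi>, d\<nu>). (hess_lagrangian P (w, la, \<mu>, \<xi>, \<nu>) *v dw + nabla (mpcc_h P) w *v dla
        + nabla (mpcc_g P) w *v d\<mu> - nabla (mpcc_G P) w *v d\<xi> - nabla (mpcc_H P) w *v d\<nu>,
        transpose (nabla (mpcc_h P) w) *v dw, - (transpose (nabla (mpcc_g P) w) *v dw),
        transpose (nabla (mpcc_G P) w) *v dw, transpose (nabla (mpcc_H P) w) *v dw)))
      (at (w, la, \<mu>, \<xi>, \<nu>))"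
    (is "(_ has_derivative ?D) (at ?z)")
proof -
  have sm: "smooth_at P w"
    using assms eventually_nhds_x_imp_x by blast
  have *: "((\<lambda>z. F (fst z)) has_derivative (\<lambda>dz. transpose (nabla F w) *v fst dz)) (at ?z)"
    if "\<And>i. (\<lambda>v. F v $ i) differentiable (at w)" for F :: "real^'n \<Rightarrow> real^'k::finite"
  proof -
    have "(F has_derivative (\<lambda>d. transpose (nabla F w) *v d)) (at (fst ?z))"
      by (simp only: fst_conv has_derivative_nabla[OF that])
    from has_derivative_compose[OF bounded_linear_imp_has_derivative[OF bounded_linear_fst] this]
    show ?thesis .
  qed
  have "((\<lambda>z. (grad_lagrangian P z, mpcc_h P (fst z), - mpcc_g P (fst z),
        mpcc_G P (fst z), mpcc_H P (fst z)))
      has_derivative (\<lambda>dz. (fst (?D dz), transpose (nabla (mpcc_h P) w) *v fst dz,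
        - (transpose (nabla (mpcc_g P) w) *v fst dz),
        transpose (nabla (mpcc_G P) w) *v fst dz, transpose (nabla (mpcc_H P) w) *v fst dz))) (at ?z)"
  proof (intro has_derivative_Pair has_derivative_minus *[of "mpcc_h P"] *[of "mpcc_g P"]
      *[of "mpcc_G P"] *[of "mpcc_H P"])
    have "(grad_lagrangian P has_derivative
        (\<lambda>(dw, dla, d\<mu>, d\<xi>, d\<nu>). hess_lagrangian P ?z *v dw + nabla (mpcc_h P) w *v dla
        + nabla (mpcc_g P) w *v d\<mu> - nabla (mpcc_G P) w *v d\<xi> - nabla (mpcc_H P) w *v d\<nu>)) (at ?z)"
      by (rule has_derivative_grad_lagrangian[OF assms])
    also have "(\<lambda>(dw, dla, d\<mu>, d\<xi>, d\<nu>). hess_lagrangian P ?z *v dw + nabla (mpcc_h P) w *v dla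
        + nabla (mpcc_g P) w *v d\<mu> - nabla (mpcc_G P) w *v d\<xi> - nabla (mpcc_H P) w *v d\<nu>)
        = (\<lambda>dz. fst (?D dz))"
      by auto
    finally show "(grad_lagrangian P has_derivative (\<lambda>dz. fst (?D dz))) (at ?z)" .
  qed (use sm in \<open>auto simp: smooth_at_def\<close>)
  also have "(\<lambda>z. (grad_lagrangian P z, mpcc_h P (fst z), - mpcc_g P (fst z),
        mpcc_G P (fst z), mpcc_H P (fst z))) = Psi P"
    by auto
  also have "(\<lambda>dz. (fst (?D dz), transpose (nabla (mpcc_h P) w) *v fst dz,
        - (transpose (nabla (mpcc_g P) w) *v fst dz),
        transpose (nabla (mpcc_G P) w) *v fst dz, transpose (nabla (mpcc_H P) w) *v fst dz)) = ?D"
    by auto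
  finally show ?thesis .
qed

lemma has_derivative_Psi_jac:
  assumes "\<forall>\<^sub>F v in nhds (fst z). smooth_at P v"
  shows "(Psi P has_derivative Psi_jac P z) (at z)"
proof -
  obtain w la \<mu> \<xi> \<nu> where z: "z = (w, la, \<mu>, \<xi>, \<nu>)"
    by (cases z)
  have "Psi P differentiable (at z)"
    unfolding differentiable_def z by (rule exI, rule has_derivative_Psi) (use assms z in simp)
  then show ?thesis
    by (simp add: Psi_jac_def frechet_derivative_works)
qed

text \<open>The added block cancels the Hessian of the Lagrangian. What remains is free of the
  multipliers \<open>y\<close>, as it must be to match the QPCC, which depends on the current
  iterate only through \<open>w\<close> and \<open>M\<close>.\<close>

lemma Psi_jac_approx_eq:
  assumes "\<forall>\<^sub>F v in nhds w. smooth_at P v"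
  shows "Psi_jac_approx P M (w, y) (dw, dla, d\<mu>, d\<xi>, d\<nu>) =
    (M *v dw + nabla (mpcc_h P) w *v dla
        + nabla (mpcc_g P) w *v d\<mu> - nabla (mpcc_G P) w *v d\<xi> - nabla (mpcc_H P) w *v d\<nu>,
        transpose (nabla (mpcc_h P) w) *v dw, - (transpose (nabla (mpcc_g P) w) *v dw),
        transpose (nabla (mpcc_G P) w) *v dw, transpose (nabla (mpcc_H P) w) *v dw)"
proof -
  obtain la \<mu> \<xi> \<nu> where y: "y = (la, \<mu>, \<xi>, \<nu>)"
    by (cases y)
  have "Psi_jac P (w, la, \<mu>, \<xi>, \<nu>) =
      (\<lambda>(dw, dla, d\<mu>, d\<xi>, d\<nu>). (hess_lagrangian P (w, la, \<mu>, \<xi>, \<nu>) *v dw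
        + nabla (mpcc_h P) w *v dla
        + nabla (mpcc_g P) w *v d\<mu> - nabla (mpcc_G P) w *v d\<xi> - nabla (mpcc_H P) w *v d\<nu>,
        transpose (nabla (mpcc_h P) w) *v dw, - (transpose (nabla (mpcc_g P) w) *v dw),
        transpose (nabla (mpcc_G P) w) *v dw, transpose (nabla (mpcc_H P) w) *v dw))"
    by (rule has_derivative_unique[OF has_derivative_Psi_jac has_derivative_Psi]) (use assms in auto)
  then show ?thesis
    by (simp add: Psi_jac_approx_def y matrix_vector_mult_diff_rdistrib zero_prod_def)
qed

definition linearization :: "(real^'n \<Rightarrow> real^'k) \<Rightarrow> real^'n \<Rightarrow> real^'n \<Rightarrow> real^'k" where
  "linearization F w d = F w + transpose (nabla F w) *v d"

section \<open>Branches of the quadratic subproblem\<close>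

definition newton_remainder ::
    "('n::finite, 'h::finite, 'g::finite, 'm::finite) mpcc \<Rightarrow> real^'n^'n \<Rightarrow>
     ('n, 'h, 'g, 'm) pdvar \<Rightarrow> ('n, 'h, 'g, 'm) pdvar \<Rightarrow> ('n, 'h, 'g, 'm) pdvar" where
  "newton_remainder P M zk z = Psi P z - Psi P zk - Psi_jac_approx P M zk (z - zk)"

fun branch_qp_KKT ::
    "('n::finite, 'h::finite, 'g::finite, 'm::finite) mpcc \<Rightarrow> 'm set \<Rightarrow>
     real^'n \<Rightarrow> real^'n^'n \<Rightarrow> ('n, 'h, 'g, 'm) pdvar \<Rightarrow> bool" where
  "branch_qp_KKT P I w M (dw, la, \<mu>, \<xi>, \<nu>) \<longleftrightarrow>
     gradient (mpcc_f P) w + M *v dw + nabla (mpcc_h P) w *v la + nabla (mpcc_g P) w *v \<mu>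
       - nabla (mpcc_G P) w *v \<xi> - nabla (mpcc_H P) w *v \<nu> = 0 \<and>
     linearization (mpcc_h P) w dw = 0 \<and>
     (\<forall>i. linearization (mpcc_g P) w dw $ i \<le> 0 \<and> 0 \<le> \<mu> $ i \<and>
        \<mu> $ i * linearization (mpcc_g P) w dw $ i = 0) \<and>
     (\<forall>i\<in>I. linearization (mpcc_G P) w dw $ i = 0 \<and> 0 \<le> linearization (mpcc_H P) w dw $ i \<and>
        0 \<le> \<nu> $ i \<and> \<nu> $ i * linearization (mpcc_H P) w dw $ i = 0) \<and>
     (\<forall>i\<in>- I. linearization (mpcc_H P) w dw $ i = 0 \<and> 0 \<le> linearization (mpcc_G P) w dw $ i \<and>
        0 \<le> \<xi> $ i \<and> \<xi> $ i * linearization (mpcc_G P) w dw $ i = 0)"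

text \<open>Subtracting the remainder from the data at \<open>z\<close> leaves exactly the
  linearized data at \<open>zk\<close>. The gradient of the Lagrangian is affine in the multipliers,
  so the old multipliers cancel; the block \<open>- mpcc_g P\<close> of \<open>Psi\<close> explains
  why the perturbation enters the inequality constraints with a plus sign.\<close>

lemma branch_KKT_remainder_iff:
  assumes "\<forall>\<^sub>F v in nhds (fst zk). smooth_at P v"
  shows "branch_KKT P I (newton_remainder P M zk z) z \<longleftrightarrow>
    branch_qp_KKT P I (fst zk) M (fst z - fst zk, snd z)"
proof -
  obtain wk lak \<mu>k \<xi>k \<nu>k where zk: "zk = (wk, lak, \<mu>k, \<xi>k, \<nu>k)"
    by (cases zk)
  obtain w la \<mu> \<xi> \<nu> where z: "z = (w, la, \<mu>, \<xi>, \<nu>)"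
    by (cases z)
  have ev: "\<forall>\<^sub>F v in nhds wk. smooth_at P v"
    using assms zk by simp
  then have sm: "smooth_at P wk"
    using eventually_nhds_x_imp_x by blast
  define X where "X = gradient (mpcc_f P) wk + M *v (w - wk) + nabla (mpcc_h P) wk *v la
    + nabla (mpcc_g P) wk *v \<mu> - nabla (mpcc_G P) wk *v \<xi> - nabla (mpcc_H P) wk *v \<nu>"
  have "newton_remainder P M zk z =
    (grad_lagrangian P z - X,
     mpcc_h P w - linearization (mpcc_h P) wk (w - wk),
     - mpcc_g P w + linearization (mpcc_g P) wk (w - wk),
     mpcc_G P w - linearization (mpcc_G P) wk (w - wk),
     mpcc_H P w - linearization (mpcc_H P) wk (w - wk))"
    unfolding newton_remainder_def zk z X_def
    by (simp add: Psi_jac_approx_eq[OF ev] grad_lagrangian_eq[OF sm] linearization_def algebra_simps)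
  then show ?thesis
    unfolding z zk by (simp flip: X_def)
qed

text \<open>The remainder is the linearization error of \<open>Psi\<close> plus the error of the
  Hessian approximation. The mean value inequality on the segment bounds the first by its largest
  derivative deviation, hence \<open>\<omega>\<close> and not half of it; the second is where
  \<open>\<kappa>\<close> enters.\<close>

lemma norm_remainder_le:
  fixes P :: "('n::finite, 'h::finite, 'g::finite, 'm::finite) mpcc"
  assumes "convex S" "zk \<in> S" "z \<in> S" "\<omega> \<ge> 0"
    and smooth: "\<And>x. x \<in> S \<Longrightarrow> \<forall>\<^sub>F v in nhds (fst x). smooth_at P v"
    and Lipschitz: "\<And>x. x \<in> S \<Longrightarrow>
      onorm (\<lambda>d. Psi_jac P x d - Psi_jac P zk d) \<le> \<omega> * norm (x - zk)"
    and approx: "onorm (\<lambda>d. Psi_jac P zk d - Psi_jac_approx P M zk d) \<le> \<kappa>"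
  shows "norm (newton_remainder P M zk z) \<le> \<kappa> * norm (z - zk) + \<omega> * (norm (z - zk))\<^sup>2"
proof -
  let ?S = "closed_segment zk z"
  have sub: "?S \<subseteq> S"
    using assms by (simp add: closed_segment_subset)
  have "norm (Psi P z - Psi P zk - Psi_jac P zk (z - zk)) \<le> norm (z - zk) * (\<omega> * norm (z - zk))"
  proof (rule differentiable_bound_linearization[where S = ?S and f' = "Psi_jac P"])
    show "zk + t *\<^sub>R (z - zk) \<in> ?S" if "t \<in> {0..1}" for t
      using that by (auto simp: closed_segment_def algebra_simps intro!: exI[of _ t])
    show "(Psi P has_derivative Psi_jac P x) (at x within ?S)" if "x \<in> ?S" for x
      using that sub smooth has_derivative_Psi_jac has_derivative_at_withinI by blast
    show "onorm (Psi_jac P x - Psi_jac P zk) \<le> \<omega> * norm (z - zk)" if "x \<in> ?S" for x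
    proof -
      have "onorm (Psi_jac P x - Psi_jac P zk) \<le> \<omega> * norm (x - zk)"
        using Lipschitz[of x] that sub by (auto simp: fun_diff_def)
      also have "\<dots> \<le> \<omega> * norm (z - zk)"
        using segment_bound(1)[OF that] assms(4) by (intro mult_left_mono) auto
      finally show ?thesis .
    qed
  qed auto
  moreover have "norm (Psi_jac P zk (z - zk) - Psi_jac_approx P M zk (z - zk)) \<le> \<kappa> * norm (z - zk)"
  proof -
    have "bounded_linear (\<lambda>d. Psi_jac P zk d - Psi_jac_approx P M zk d)"
      unfolding Psi_jac_approx_def
      by (simp add: bounded_linear_minus bounded_linear_Pair linear_compose
            bounded_linear_compose[OF matrix_vector_mul_bounded_linear bounded_linear_fst])
    then have "norm (Psi_jac P zk (z - zk) - Psi_jac_approx P M zk (z - zk)) \<le>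
        onorm (\<lambda>d. Psi_jac P zk d - Psi_jac_approx P M zk d) * norm (z - zk)"
      by (rule onorm)
    also have "\<dots> \<le> \<kappa> * norm (z - zk)"
      by (intro mult_right_mono approx) auto
    finally show ?thesis .
  qed
  ultimately show ?thesis
    unfolding newton_remainder_def power2_eq_square
    using norm_triangle_ineq[of "Psi P z - Psi P zk - Psi_jac P zk (z - zk)"
        "Psi_jac P zk (z - zk) - Psi_jac_approx P M zk (z - zk)"]
    by (simp add: algebra_simps)
qed

lemma continuous_on_remainder:
  assumes "\<And>x. x \<in> S \<Longrightarrow> \<forall>\<^sub>F v in nhds (fst x). smooth_at P v"
    and "\<forall>\<^sub>F v in nhds (fst zk). smooth_at P v"
  shows "continuous_on S (newton_remainder P M zk)"
proof -
  have "continuous_on S (Psi P)"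
    using assms(1) has_derivative_Psi_jac has_derivative_continuous
    by (metis continuous_at_imp_continuous_on)
  moreover have "bounded_linear (Psi_jac_approx P M zk)"
    unfolding Psi_jac_approx_def
    by (intro bounded_linear_add has_derivative_bounded_linear[OF has_derivative_Psi_jac[OF assms(2)]]
        bounded_linear_Pair bounded_linear_zero
            bounded_linear_compose[OF matrix_vector_mul_bounded_linear bounded_linear_fst])
  ultimately show ?thesis
    unfolding newton_remainder_def
    by (intro continuous_intros bounded_linear.continuous_on[of "Psi_jac_approx P M zk"])
qed

section \<open>Strict convexity, uniqueness of multipliers and the best branch\<close>

definition branch_qp_feasible ::
    "('n::finite, 'h::finite, 'g::finite, 'm::finite) mpcc \<Rightarrow> 'm set \<Rightarrow> real^'n \<Rightarrow> real^'n \<Rightarrow> bool" where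
  "branch_qp_feasible P I w d \<longleftrightarrow>
     linearization (mpcc_h P) w d = 0 \<and> (\<forall>i. linearization (mpcc_g P) w d $ i \<le> 0) \<and>
     (\<forall>i\<in>I. linearization (mpcc_G P) w d $ i = 0 \<and> 0 \<le> linearization (mpcc_H P) w d $ i) \<and>
     (\<forall>i\<in>- I. linearization (mpcc_H P) w d $ i = 0 \<and> 0 \<le> linearization (mpcc_G P) w d $ i)"

definition qp_objective ::
    "('n::finite, 'h::finite, 'g::finite, 'm::finite) mpcc \<Rightarrow> real^'n \<Rightarrow> real^'n^'n \<Rightarrow> real^'n \<Rightarrow> real"
  where "qp_objective P w M d = gradient (mpcc_f P) w \<bullet> d + d \<bullet> (M *v d) / 2"

text \<open>The second order Taylor expansion, exact for a quadratic; the symmetry contained in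
  \<open>pos_def\<close> merges the two mixed terms.\<close>

lemma qp_objective_diff:
  assumes "pos_def M"
  shows "qp_objective P w M d' - qp_objective P w M d =
    (gradient (mpcc_f P) w + M *v d) \<bullet> (d' - d) + (d' - d) \<bullet> (M *v (d' - d)) / 2"
proof -
  have "d' \<bullet> (M *v d) = d \<bullet> (M *v d')"
    using assms matrix_mult_inner_eq[of M d d'] by (simp add: pos_def_def inner_commute)
  then show ?thesis
    by (simp add: qp_objective_def matrix_vector_mult_diff_distrib inner_diff_left inner_diff_right
        inner_add_left inner_add_right inner_commute field_simps)
qed

text \<open>Stationarity writes the gradient of the objective at \<open>d\<close> as a combination
  of constraint gradients, each term of which has the right sign along \<open>d' - d\<close>. The
  first order term is therefore nonnegative, while the quadratic term is positive unless
  \<open>d' = d\<close>.\<close>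

lemma branch_qp_KKT_unique_minimizer:
  fixes P :: "('n::finite, 'h::finite, 'g::finite, 'm::finite) mpcc"
  assumes M: "pos_def M"
    and KKT: "branch_qp_KKT P I w M (d, la, \<mu>, \<xi>, \<nu>)"
    and feas: "branch_qp_feasible P I w d'"
    and le: "qp_objective P w M d' \<le> qp_objective P w M d"
  shows "d' = d"
proof (rule ccontr)
  assume "d' \<noteq> d"
  then have "0 < (d' - d) \<bullet> (M *v (d' - d))"
    using M by (simp add: pos_def_def)
  have *: "(nabla F w *v y) \<bullet> (d' - d) =
      (\<Sum>i\<in>UNIV. y $ i * (linearization F w d' $ i - linearization F w d $ i))"
    for F :: "real^'n \<Rightarrow> real^'k::finite" and y
    unfolding matrix_mult_inner_eq
    by (simp add: linearization_def matrix_vector_mult_diff_distrib inner_vec_def)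
  \<comment> \<open>Complementarity at \<open>d\<close> removes the term with the old constraint
    value \<open>a\<close>; feasibility of \<open>d'\<close> gives the sign of the new value
    \<open>b\<close>.\<close>
  have comp: "0 \<le> x * (b - a)" if "x * a = 0" "0 \<le> x" "0 \<le> b" for x a b :: real
    using that by (simp only: right_diff_distrib diff_0_right mult_nonneg_nonneg)
  have "(nabla (mpcc_h P) w *v la) \<bullet> (d' - d) = 0"
    using KKT feas by (simp add: * branch_qp_feasible_def)
  moreover have "(nabla (mpcc_g P) w *v \<mu>) \<bullet> (d' - d) \<le> 0"
    unfolding *
  proof (rule sum_nonpos)
    fix i
    have "\<mu> $ i * linearization (mpcc_g P) w d $ i = 0" "0 \<le> \<mu> $ i"
        "linearization (mpcc_g P) w d' $ i \<le> 0"
      using KKT feas by (auto simp: branch_qp_feasible_def)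
    then show "\<mu> $ i * (linearization (mpcc_g P) w d' $ i - linearization (mpcc_g P) w d $ i) \<le> 0"
      by (simp only: right_diff_distrib mult_nonneg_nonpos diff_0_right)
  qed
  moreover have "0 \<le> (nabla (mpcc_G P) w *v \<xi>) \<bullet> (d' - d)"
    unfolding *
  proof (rule sum_nonneg)
    \<comment> \<open>For \<open>i \<in> I\<close> the multiplier has no sign, but both linearized
      values of \<open>G\<close> vanish; for the other indices \<open>comp\<close> applies. The sum
      for \<open>H\<close> is treated with the roles exchanged.\<close>
    show "0 \<le> \<xi> $ i * (linearization (mpcc_G P) w d' $ i - linearization (mpcc_G P) w d $ i)" for i
      using KKT feas comp[of "\<xi> $ i"] by (cases "i \<in> I") (auto simp: branch_qp_feasible_def)
  qed
  moreover have "0 \<le> (nabla (mpcc_H P) w *v \<nu>) \<bullet> (d' - d)"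
    unfolding *
  proof (rule sum_nonneg)
    show "0 \<le> \<nu> $ i * (linearization (mpcc_H P) w d' $ i - linearization (mpcc_H P) w d $ i)" for i
      using KKT feas comp[of "\<nu> $ i"] by (cases "i \<in> I") (auto simp: branch_qp_feasible_def)
  qed
  moreover have "gradient (mpcc_f P) w + M *v d = - (nabla (mpcc_h P) w *v la) - nabla (mpcc_g P) w *v \<mu>
      + nabla (mpcc_G P) w *v \<xi> + nabla (mpcc_H P) w *v \<nu>"
    using KKT by (simp add: algebra_simps eq_neg_iff_add_eq_0 add_eq_0_iff)
  ultimately have "0 \<le> (gradient (mpcc_f P) w + M *v d) \<bullet> (d' - d)"
    by (simp only: inner_add_left inner_diff_left inner_minus_left)
  then show False
    using le qp_objective_diff[OF M, of P w d' d] \<open>0 < (d' - d) \<bullet> (M *v (d' - d))\<close> by linarith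
qed

text \<open>Excludes new active constraints in the QPCC, so that by complementarity its multipliers
  are supported on the indices active at \<open>a\<close>.\<close>

definition active_nearby ::
    "('n::finite, 'h::finite, 'g::finite, 'm::finite) mpcc \<Rightarrow> real^'n \<Rightarrow> real^'n \<Rightarrow> real^'n \<Rightarrow> bool"
  where
  "active_nearby P a w d \<longleftrightarrow>
     (\<forall>i. linearization (mpcc_g P) w d $ i = 0 \<longrightarrow> i \<in> act P a) \<and>
     (\<forall>i. linearization (mpcc_G P) w d $ i = 0 \<longrightarrow> i \<in> I0p P a \<union> I00 P a) \<and>
     (\<forall>i. linearization (mpcc_H P) w d $ i = 0 \<longrightarrow> i \<in> Ip0 P a \<union> I00 P a)"

text \<open>Gradients are taken at \<open>w\<close>, the active indices at \<open>a\<close>. Linear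
  independence is phrased with full coefficient vectors supported on those indices, so that
  differences of multipliers can be inserted directly.\<close>

definition LICQ_nearby ::
    "('n::finite, 'h::finite, 'g::finite, 'm::finite) mpcc \<Rightarrow> real^'n \<Rightarrow> real^'n \<Rightarrow> bool" where
  "LICQ_nearby P a w \<longleftrightarrow>
     (\<forall>la \<mu> \<xi> \<nu>. nabla (mpcc_h P) w *v la + nabla (mpcc_g P) w *v \<mu>
         - nabla (mpcc_G P) w *v \<xi> - nabla (mpcc_H P) w *v \<nu> = 0 \<longrightarrow>
       (\<forall>i. i \<notin> act P a \<longrightarrow> \<mu> $ i = 0) \<longrightarrow> (\<forall>i. i \<notin> I0p P a \<union> I00 P a \<longrightarrow> \<xi> $ i = 0) \<longrightarrow>
       (\<forall>i. i \<notin> Ip0 P a \<union> I00 P a \<longrightarrow> \<nu> $ i = 0) \<longrightarrow> la = 0 \<and> \<mu> = 0 \<and> \<xi> = 0 \<and> \<nu> = 0)"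

text \<open>Both multipliers solve the same stationarity equation at \<open>d\<close>, so their
  difference is a vanishing combination of constraint gradients.\<close>

lemma qp_multipliers_unique:
  assumes "branch_qp_KKT P I w M (d, la, \<mu>, \<xi>, \<nu>)"
    and "branch_qp_KKT P J w M (d, la', \<mu>', \<xi>', \<nu>')"
    and act: "active_nearby P a w d" and LICQ: "LICQ_nearby P a w"
  shows "(la, \<mu>, \<xi>, \<nu>) = (la', \<mu>', \<xi>', \<nu>')"
proof -
  let ?H = "linearization (mpcc_H P) w d" and ?G = "linearization (mpcc_G P) w d"
  have KKT_g: "\<mu> $ i * linearization (mpcc_g P) w d $ i = 0 \<and> \<mu>' $ i * linearization (mpcc_g P) w d $ i = 0"
    for i
    using assms(1,2) by auto
  \<comment> \<open>These products vanish on either side of a partition, by the equality constraint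
    on one side and complementarity on the other. So two different branches can be compared.\<close>
  have KKT: "\<xi> $ i * ?G $ i = 0 \<and> \<xi>' $ i * ?G $ i = 0 \<and> \<nu> $ i * ?H $ i = 0 \<and> \<nu>' $ i * ?H $ i = 0" for i
    using assms(1,2) by (cases "i \<in> I"; cases "i \<in> J") auto
  have "nabla (mpcc_h P) w *v (la - la') + nabla (mpcc_g P) w *v (\<mu> - \<mu>')
      - nabla (mpcc_G P) w *v (\<xi> - \<xi>') - nabla (mpcc_H P) w *v (\<nu> - \<nu>') =
      (gradient (mpcc_f P) w + M *v d + nabla (mpcc_h P) w *v la + nabla (mpcc_g P) w *v \<mu>
       - nabla (mpcc_G P) w *v \<xi> - nabla (mpcc_H P) w *v \<nu>)
      - (gradient (mpcc_f P) w + M *v d + nabla (mpcc_h P) w *v la' + nabla (mpcc_g P) w *v \<mu>'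
       - nabla (mpcc_G P) w *v \<xi>' - nabla (mpcc_H P) w *v \<nu>')"
    by (simp add: matrix_vector_mult_diff_distrib)
  also have "\<dots> = 0"
    using assms(1,2) by simp
  finally have "nabla (mpcc_h P) w *v (la - la') + nabla (mpcc_g P) w *v (\<mu> - \<mu>')
      - nabla (mpcc_G P) w *v (\<xi> - \<xi>') - nabla (mpcc_H P) w *v (\<nu> - \<nu>') = 0" .
  moreover have "(\<mu> - \<mu>') $ i = 0" if "i \<notin> act P a" for i
    using KKT_g[of i] act that by (auto simp: active_nearby_def)
  moreover have "(\<xi> - \<xi>') $ i = 0" if "i \<notin> I0p P a \<union> I00 P a" for i
    using KKT[of i] act that by (auto simp: active_nearby_def)
  moreover have "(\<nu> - \<nu>') $ i = 0" if "i \<notin> Ip0 P a \<union> I00 P a" for i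
    using KKT[of i] act that by (auto simp: active_nearby_def)
  ultimately have "la - la' = 0 \<and> \<mu> - \<mu>' = 0 \<and> \<xi> - \<xi>' = 0 \<and> \<nu> - \<nu>' = 0"
    using LICQ unfolding LICQ_nearby_def by blast
  then show ?thesis
    by simp
qed

lemma branch_qp_KKT_feasible:
  assumes "branch_qp_KKT P I w M (d, la, \<mu>, \<xi>, \<nu>)"
  shows "branch_qp_feasible P I w d"
  using assms by (auto simp: branch_qp_feasible_def)

text \<open>A branch leaves open the signs of \<open>\<xi>\<close> on \<open>I\<close> and of
  \<open>\<nu>\<close> off \<open>I\<close>. The QPCC asks for these signs only at biactive indices,
  and its vanishing multipliers elsewhere follow from complementarity in the branch.\<close>

lemma qpcc_S_stationaryI:
  assumes KKT: "branch_qp_KKT P I w M (d, la, \<mu>, \<xi>, \<nu>)"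
    and bi: "\<And>i. linearization (mpcc_G P) w d $ i = 0 \<Longrightarrow> linearization (mpcc_H P) w d $ i = 0 \<Longrightarrow>
      0 \<le> \<xi> $ i \<and> 0 \<le> \<nu> $ i"
  shows "qpcc_S_stationary P w M (d, la, \<mu>, \<xi>, \<nu>)"
proof -
  let ?H = "linearization (mpcc_H P) w d" and ?G = "linearization (mpcc_G P) w d"
  have "0 \<le> ?G $ i \<and> 0 \<le> ?H $ i \<and> ?G $ i * ?H $ i = 0 \<and>
      (?G $ i = 0 \<and> ?H $ i > 0 \<longrightarrow> \<nu> $ i = 0) \<and> (?G $ i > 0 \<and> ?H $ i = 0 \<longrightarrow> \<xi> $ i = 0)" for i
    using KKT by (cases "i \<in> I") auto
  then show ?thesis
    using KKT bi unfolding qpcc_S_stationary.simps Let_def linearization_def[symmetric] by auto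
qed

lemma qpcc_S_stationary_imp_branch_qp_KKT:
  assumes S: "qpcc_S_stationary P w M (d, la, \<mu>, \<xi>, \<nu>)"
    and act: "active_nearby P a w d" and feas: "feasible P a"
  shows "\<exists>I\<in>partitions P a. branch_qp_KKT P I w M (d, la, \<mu>, \<xi>, \<nu>)"
proof -
  let ?H = "linearization (mpcc_H P) w d" and ?G = "linearization (mpcc_G P) w d"
  \<comment> \<open>On the indices that are not biactive at \<open>a\<close>,
    \<open>active_nearby\<close> decides which side vanishes. Indices biactive in the QPCC are put
    on the \<open>G\<close> side; S-stationarity supplies both signs there, so this choice is
    harmless.\<close>
  let ?I = "I0p P a \<union> {i \<in> I00 P a. ?G $ i = 0}"
  have comp: "0 \<le> ?G $ i" "0 \<le> ?H $ i" "?G $ i * ?H $ i = 0"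
      "?G $ i = 0 \<and> ?H $ i > 0 \<longrightarrow> \<nu> $ i = 0" "?G $ i > 0 \<and> ?H $ i = 0 \<longrightarrow> \<xi> $ i = 0"
      "?G $ i = 0 \<and> ?H $ i = 0 \<longrightarrow> 0 \<le> \<xi> $ i \<and> 0 \<le> \<nu> $ i" for i
    using S unfolding qpcc_S_stationary.simps Let_def linearization_def[symmetric] by auto
  have a: "i \<in> I0p P a \<or> i \<in> Ip0 P a \<or> i \<in> I00 P a" for i
    using feas unfolding feasible_def I0p_def Ip0_def I00_def
    by (auto simp: less_le)
  have I: "?G $ i = 0" if "i \<in> ?I" for i
    using that comp(3)[of i] act by (auto simp: active_nearby_def I0p_def Ip0_def I00_def)
  have mI: "?H $ i = 0 \<and> 0 < ?G $ i" if "i \<notin> ?I" for i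
    using that comp(1,3)[of i] act a[of i] by (auto simp: active_nearby_def less_le I0p_def Ip0_def I00_def)
  have "branch_qp_KKT P ?I w M (d, la, \<mu>, \<xi>, \<nu>)"
    unfolding branch_qp_KKT.simps
  proof (intro conjI ballI)
    fix i
    {
      assume i: "i \<in> ?I"
      show "?G $ i = 0" "0 \<le> ?H $ i"
        using I[OF i] comp by auto
      show "0 \<le> \<nu> $ i" "\<nu> $ i * ?H $ i = 0"
        using I[OF i] comp[of i] by (auto simp: less_le)
    next
      assume "i \<in> - ?I"
      then have i: "i \<notin> ?I" by blast
      show "?H $ i = 0" "0 \<le> ?G $ i" "0 \<le> \<xi> $ i" "\<xi> $ i * ?G $ i = 0"
        using mI[OF i] comp[of i] by auto
    }
  qed (use S in \<open>auto simp: Let_def linearization_def\<close>)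
  moreover have "?I \<in> partitions P a"
    by (auto simp: partitions_def)
  ultimately show ?thesis
    by blast
qed

lemma exists_qpcc_S_stationary:
  assumes M: "pos_def M"
    and LICQ: "LICQ_nearby P a w"
    and z: "\<And>I. I \<in> partitions P a \<Longrightarrow> branch_qp_KKT P I w M (z I)"
    and act: "\<And>I. I \<in> partitions P a \<Longrightarrow> active_nearby P a w (fst (z I))"
  shows "\<exists>I\<in>partitions P a. qpcc_S_stationary P w M (z I)"
proof -
  have fin: "finite (partitions P a)"
    by simp
  have "partitions P a \<noteq> {}"
    by (auto simp: partitions_def)
  then obtain I where I: "I \<in> partitions P a"
    and min: "\<And>J. J \<in> partitions P a \<Longrightarrow> qp_objective P w M (fst (z I)) \<le> qp_objective P w M (fst (z J))"
    using arg_min_if_finite[OF fin, of "\<lambda>J. qp_objective P w M (fst (z J))"]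
    by (metis (no_types, lifting) not_less)
  obtain d la \<mu> \<xi> \<nu> where zI: "z I = (d, la, \<mu>, \<xi>, \<nu>)"
    by (cases "z I")
  let ?H = "linearization (mpcc_H P) w d" and ?G = "linearization (mpcc_G P) w d"
  have actI: "active_nearby P a w d"
    using act[OF I] zI by simp
  have KKT: "branch_qp_KKT P I w M (d, la, \<mu>, \<xi>, \<nu>)"
    using z[OF I] zI by simp
  \<comment> \<open>If \<open>d\<close> is also feasible for \<open>J\<close>, it is no worse than
    the minimizer of branch \<open>J\<close>, because \<open>I\<close> was chosen with the least
    objective value. Strict convexity and LICQ then identify the two primal-dual points.\<close>
  have switch: "z J = z I" if "J \<in> partitions P a" "branch_qp_feasible P J w d" for J
  proof -
    obtain d' la' \<mu>' \<xi>' \<nu>' where zJ: "z J = (d', la', \<mu>', \<xi>', \<nu>')"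
      by (cases "z J")
    have KKT': "branch_qp_KKT P J w M (d', la', \<mu>', \<xi>', \<nu>')"
      using z[OF that(1)] zJ by simp
    have "d = d'"
      using branch_qp_KKT_unique_minimizer[OF M KKT' that(2)] min[OF that(1)] zI zJ by simp
    then show ?thesis
      using qp_multipliers_unique[OF KKT KKT'[folded \<open>d = d'\<close>] actI LICQ] zI zJ by simp
  qed
  have "0 \<le> \<xi> $ i \<and> 0 \<le> \<nu> $ i" if i: "?G $ i = 0" "?H $ i = 0" for i
  proof -
    have i00: "i \<in> I00 P a"
      using actI i by (auto simp: active_nearby_def I0p_def Ip0_def I00_def)
    have feas: "branch_qp_feasible P J w d" if "J = insert i I \<or> J = I - {i}" for J
      using branch_qp_KKT_feasible[OF KKT] i that by (auto simp: branch_qp_feasible_def)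
    have "insert i I \<in> partitions P a" "I - {i} \<in> partitions P a"
      using I i00 unfolding partitions_def
      by (blast, auto simp: I0p_def I00_def intro!: exI[of _ "I \<inter> I00 P a - {i}"])
    \<comment> \<open>With \<open>i\<close> on the \<open>G\<close> side the KKT conditions contain
      the sign of \<open>\<nu>\<close>, with \<open>i\<close> on the \<open>H\<close> side that of
      \<open>\<xi>\<close>.\<close>
    then have "branch_qp_KKT P (insert i I) w M (d, la, \<mu>, \<xi>, \<nu>)"
        "branch_qp_KKT P (I - {i}) w M (d, la, \<mu>, \<xi>, \<nu>)"
      using z switch feas zI by metis+
    then show ?thesis
      by auto
  qed
  then have "qpcc_S_stationary P w M (z I)"
    unfolding zI by (rule qpcc_S_stationaryI[OF KKT])
  then show ?thesis
    using I by blast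
qed

section \<open>Constraint qualification and active sets near the solution\<close>

lemma isCont_imp_tendsto_nhds: "isCont f x \<Longrightarrow> (f \<longlongrightarrow> f x) (nhds x)"
  by (simp add: isCont_def tendsto_at_iff_tendsto_nhds)

text \<open>The linear map from coefficients supported on \<open>A\<close> to combinations of the
  family at \<open>a\<close> is injective on a finite-dimensional space, hence bounded below by some
  \<open>e > 0\<close>. A perturbation of the family of total size less than \<open>e\<close> cannot
  create a kernel.\<close>

lemma eventually_independent_family:
  fixes c :: "real^'n \<Rightarrow> 'i::finite \<Rightarrow> real^'n"
  assumes cont: "\<And>i. isCont (\<lambda>w. c w i) a"
    and inj: "inj_on (c a) A" and ind: "independent (c a ` A)"
  shows "\<forall>\<^sub>F w in nhds a. \<forall>x :: real^'i.
    (\<Sum>i\<in>UNIV. x $ i *\<^sub>R c w i) = 0 \<longrightarrow> (\<forall>i. i \<notin> A \<longrightarrow> x $ i = 0) \<longrightarrow> x = 0"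
proof -
  define f where "f w x = (\<Sum>i\<in>UNIV. x $ i *\<^sub>R c w i)" for w and x :: "real^'i"
  define S where "S = {x :: real^'i. \<forall>i. i \<notin> A \<longrightarrow> x $ i = 0}"
  have sub: "subspace S"
    by (auto simp: S_def subspace_def)
  have bl: "bounded_linear (f a)"
    unfolding f_def
    by (intro bounded_linear_sum bounded_linear_scaleR_left[THEN bounded_linear_compose] bounded_linear_vec_nth)
  have inj0: "x = 0" if "x \<in> S" "f a x = 0" for x
  proof -
    \<comment> \<open>\<open>independent\<close> speaks of a set of vectors, so the coefficients are
      carried from indices to vectors along the injection.\<close>
    let ?u = "\<lambda>v. x $ the_inv_into A (c a) v"
    have "(\<Sum>v\<in>c a ` A. ?u v *\<^sub>R v) = (\<Sum>i\<in>A. x $ i *\<^sub>R c a i)"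
      using inj by (simp add: sum.reindex the_inv_into_f_f)
    also have "\<dots> = f a x"
      unfolding f_def using that(1) by (intro sum.mono_neutral_left) (auto simp: S_def)
    finally have "(\<Sum>v\<in>c a ` A. ?u v *\<^sub>R v) = 0"
      using that(2) by simp
    then have "?u (c a i) = 0" if "i \<in> A" for i
      using independentD[OF ind, of "c a ` A" ?u] that by auto
    then have "x $ i = 0" if "i \<in> A" for i
      using that inj by (simp add: the_inv_into_f_f)
    then show ?thesis
      using that(1) by (auto simp: S_def vec_eq_iff)
  qed
  obtain e where e: "e > 0" "\<And>x. x \<in> S \<Longrightarrow> e * norm x \<le> norm (f a x)"
    using injective_imp_isometric[OF closed_subspace[OF sub] sub bl] inj0 by blast
  have "((\<lambda>w. c w i) \<longlongrightarrow> c a i) (nhds a)" for i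
    using isCont_imp_tendsto_nhds[OF cont] .
  then have "((\<lambda>w. \<Sum>i\<in>UNIV. norm (c w i - c a i)) \<longlongrightarrow> (\<Sum>i\<in>UNIV. norm (c a i - c a i))) (nhds a)"
    by (intro tendsto_sum tendsto_norm tendsto_diff tendsto_const)
  then have "\<forall>\<^sub>F w in nhds a. (\<Sum>i\<in>UNIV. norm (c w i - c a i)) < e"
    using e(1) by (intro order_tendstoD(2)) auto
  then show ?thesis
  proof eventually_elim
    case (elim w)
    have "x = 0" if x: "f w x = 0" "x \<in> S" for x
    proof (rule ccontr)
      assume "x \<noteq> 0"
      have "f a x = - (\<Sum>i\<in>UNIV. x $ i *\<^sub>R (c w i - c a i))"
        using x(1) by (simp add: f_def scaleR_right_diff_distrib sum_subtractf)
      then have "norm (f a x) = norm (\<Sum>i\<in>UNIV. x $ i *\<^sub>R (c w i - c a i))"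
        by simp
      also have "\<dots> \<le> (\<Sum>i\<in>UNIV. norm (x $ i *\<^sub>R (c w i - c a i)))"
        by (rule norm_sum)
      also have "\<dots> \<le> (\<Sum>i\<in>UNIV. norm x * norm (c w i - c a i))"
        by (intro sum_mono) (auto intro!: mult_right_mono component_le_norm_cart)
      also have "\<dots> = norm x * (\<Sum>i\<in>UNIV. norm (c w i - c a i))"
        by (simp add: sum_distrib_left)
      also have "\<dots> < norm x * e"
        using elim \<open>x \<noteq> 0\<close> by simp
      finally show False
        using e(2)[OF x(2)] by (simp add: mult.commute)
    qed
    then show ?case
      unfolding f_def S_def by blast
  qed
qed

lemma sum_UNIV_sum:
  "(\<Sum>i\<in>UNIV. f i) = (\<Sum>i\<in>UNIV. f (Inl i)) + (\<Sum>i\<in>UNIV. f (Inr i))"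
  for f :: "'a::finite + 'b::finite \<Rightarrow> 'c::comm_monoid_add"
  using sum.Plus[of UNIV UNIV f] by simp

lemma eventually_LICQ_nearby:
  fixes P :: "('n::finite, 'h::finite, 'g::finite, 'm::finite) mpcc"
  assumes smooth: "smooth_data P a" and LICQ: "mpcc_LICQ P a"
  shows "\<forall>\<^sub>F w in nhds a. LICQ_nearby P a w"
proof -
  define A where "A = (UNIV :: 'h set) <+> (act P a <+> ((I0p P a \<union> I00 P a) <+> (Ip0 P a \<union> I00 P a)))"
  let ?c = "constraint_gradient P"
  note ev = eventually_smooth_at[OF smooth]
  have "smooth_at P a"
    using ev eventually_nhds_x_imp_x by blast
  then have "isCont (gradient (\<lambda>v. mpcc_h P v $ j)) a" "isCont (gradient (\<lambda>v. mpcc_g P v $ k)) a"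
      "isCont (gradient (\<lambda>v. mpcc_G P v $ l)) a" "isCont (gradient (\<lambda>v. mpcc_H P v $ l)) a" for j k l
    by (auto simp: smooth_at_def intro: differentiable_imp_continuous_within)
  note cont_gradient = this
  have cont: "isCont (\<lambda>w. ?c w i) a" for i
  proof -
    consider j where "i = Inl j" | j where "i = Inr (Inl j)" | j where "i = Inr (Inr (Inl j))"
      | j where "i = Inr (Inr (Inr j))"
      by (metis sumE)
    then show ?thesis
      by cases (simp_all add: constraint_gradient_def cont_gradient)
  qed
  have "inj_on (?c a) A" "independent (?c a ` A)"
    using LICQ by (auto simp: mpcc_LICQ_def A_def Let_def)
  from eventually_independent_family[OF cont this] ev
  show ?thesis
  proof eventually_elim
    case (elim w)
    show ?case
      unfolding LICQ_nearby_def
    proof (intro allI impI)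
      fix la \<mu> \<xi> \<nu>
      assume 0: "nabla (mpcc_h P) w *v la + nabla (mpcc_g P) w *v \<mu>
         - nabla (mpcc_G P) w *v \<xi> - nabla (mpcc_H P) w *v \<nu> = 0"
        and z: "\<forall>i. i \<notin> act P a \<longrightarrow> \<mu> $ i = 0" "\<forall>i. i \<notin> I0p P a \<union> I00 P a \<longrightarrow> \<xi> $ i = 0"
          "\<forall>i. i \<notin> Ip0 P a \<union> I00 P a \<longrightarrow> \<nu> $ i = 0"
      \<comment> \<open>The minus signs follow the sign convention of the Lagrangian for
        \<open>G\<close> and \<open>H\<close>.\<close>
      define x :: "real^('h + 'g + 'm + 'm)" where
        "x = (\<chi> i. case_sum (\<lambda>i. la $ i) (case_sum (\<lambda>i. \<mu> $ i) (case_sum (\<lambda>i. - \<xi> $ i) (\<lambda>i. - \<nu> $ i))) i)"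
      have "(\<Sum>i\<in>UNIV. x $ i *\<^sub>R ?c w i) = nabla (mpcc_h P) w *v la + nabla (mpcc_g P) w *v \<mu>
         - nabla (mpcc_G P) w *v \<xi> - nabla (mpcc_H P) w *v \<nu>"
        using elim(2)
        by (simp add: sum_UNIV_sum x_def constraint_gradient_def nabla_mult smooth_at_def sum_negf)
      moreover have "x $ i = 0" if "i \<notin> A" for i
        using that z by (auto simp: x_def A_def split: sum.split)
      ultimately have "x = 0"
        using elim(1) 0 by auto
      then have "x $ Inl i = 0" "x $ Inr (Inl j) = 0" "x $ Inr (Inr (Inl k)) = 0" "x $ Inr (Inr (Inr k)) = 0"
        for i j k by simp_all
      then show "la = 0 \<and> \<mu> = 0 \<and> \<xi> = 0 \<and> \<nu> = 0"
        by (simp add: x_def vec_eq_iff)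
    qed
  qed
qed

text \<open>The linearization at one point, evaluated at another, tends to \<open>F a\<close> when
  both points tend to \<open>a\<close>. Base point and target move independently, hence the filter
  on pairs.\<close>

lemma eventually_linearization_nonzero:
  fixes F :: "real^'n \<Rightarrow> real^'k"
  assumes F: "\<And>i. twice_diff_near (\<lambda>v. F v $ i) a"
  shows "\<forall>\<^sub>F p in nhds (a, a). \<forall>i. F a $ i \<noteq> 0 \<longrightarrow> linearization F (fst p) (snd p - fst p) $ i \<noteq> 0"
proof -
  have d: "\<forall>\<^sub>F w in nhds a. \<forall>i. (\<lambda>v. F v $ i) differentiable (at w) \<and> gradient (\<lambda>v. F v $ i) differentiable (at w)"
    using F unfolding twice_diff_near_def by (intro eventually_all_finite) auto
  have ev: "\<forall>\<^sub>F p in nhds (a, a). \<forall>i. (\<lambda>v. F v $ i) differentiable (at (fst p))"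
  proof -
    have "filterlim fst (nhds a) (nhds (a, a))"
      using tendsto_fst[OF filterlim_ident, of "(a, a)"] by simp
    from eventually_compose_filterlim[OF d this] show ?thesis
      by (rule eventually_mono) blast
  qed
  have lin: "\<forall>\<^sub>F p in nhds (a, a). F a $ i \<noteq> 0 \<longrightarrow>
      F (fst p) $ i + gradient (\<lambda>v. F v $ i) (fst p) \<bullet> (snd p - fst p) \<noteq> 0" for i
  proof (cases "F a $ i = 0")
    case False
    have "isCont (\<lambda>v. F v $ i) a" "isCont (gradient (\<lambda>v. F v $ i)) a"
      using eventually_nhds_x_imp_x[OF d] by (auto intro: differentiable_imp_continuous_within)
    then have "isCont (\<lambda>p. F (fst p) $ i) (a, a)" "isCont (\<lambda>p. gradient (\<lambda>v. F v $ i) (fst p)) (a, a)"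
      by (auto intro!: isCont_o2[where f = fst and g = "\<lambda>v. F v $ i"]
          isCont_o2[where f = fst and g = "gradient (\<lambda>v. F v $ i)"])
    then have "isCont (\<lambda>p. F (fst p) $ i + gradient (\<lambda>v. F v $ i) (fst p) \<bullet> (snd p - fst p)) (a, a)"
      by (intro continuous_add continuous_inner continuous_diff continuous_fst continuous_snd continuous_ident)
    from isCont_imp_tendsto_nhds[OF this]
    have "((\<lambda>p. F (fst p) $ i + gradient (\<lambda>v. F v $ i) (fst p) \<bullet> (snd p - fst p)) \<longlongrightarrow> F a $ i) (nhds (a, a))"
      by simp
    from tendsto_imp_eventually_ne[OF this False] show ?thesis
      by (rule eventually_mono) simp
  qed simp
  show ?thesis
    using ev eventually_all_finite[of "\<lambda>p i. F a $ i \<noteq> 0 \<longrightarrow>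
      F (fst p) $ i + gradient (\<lambda>v. F v $ i) (fst p) \<bullet> (snd p - fst p) \<noteq> 0", OF lin]
    by eventually_elim
       (simp add: linearization_def transpose_nabla_mult_component del: transpose_matrix_vector)
qed

lemma eventually_active_nearby:
  assumes smooth: "smooth_data P a" and feas: "feasible P a"
  shows "\<forall>\<^sub>F p in nhds (a, a). active_nearby P a (fst p) (snd p - fst p)"
proof -
  have "\<forall>\<^sub>F p in nhds (a, a). \<forall>i. mpcc_g P a $ i \<noteq> 0 \<longrightarrow> linearization (mpcc_g P) (fst p) (snd p - fst p) $ i \<noteq> 0"
    "\<forall>\<^sub>F p in nhds (a, a). \<forall>i. mpcc_G P a $ i \<noteq> 0 \<longrightarrow> linearization (mpcc_G P) (fst p) (snd p - fst p) $ i \<noteq> 0"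
    "\<forall>\<^sub>F p in nhds (a, a). \<forall>i. mpcc_H P a $ i \<noteq> 0 \<longrightarrow> linearization (mpcc_H P) (fst p) (snd p - fst p) $ i \<noteq> 0"
    using smooth by (auto simp: smooth_data_def intro!: eventually_linearization_nonzero)
  then have "\<forall>\<^sub>F p in nhds (a, a).
      (\<forall>i. mpcc_g P a $ i \<noteq> 0 \<longrightarrow> linearization (mpcc_g P) (fst p) (snd p - fst p) $ i \<noteq> 0) \<and>
      (\<forall>i. mpcc_G P a $ i \<noteq> 0 \<longrightarrow> linearization (mpcc_G P) (fst p) (snd p - fst p) $ i \<noteq> 0) \<and>
      (\<forall>i. mpcc_H P a $ i \<noteq> 0 \<longrightarrow> linearization (mpcc_H P) (fst p) (snd p - fst p) $ i \<noteq> 0)"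
    by (simp add: eventually_conj_iff)
  moreover have "i \<in> I0p P a \<union> I00 P a \<longleftrightarrow> mpcc_G P a $ i = 0" "i \<in> Ip0 P a \<union> I00 P a \<longleftrightarrow> mpcc_H P a $ i = 0" for i
    using feas by (auto simp: feasible_def I0p_def Ip0_def I00_def less_le)
  ultimately show ?thesis
    unfolding active_nearby_def act_def by (auto elim: eventually_mono)
qed

section \<open>The local iteration\<close>

text \<open>Late iterates inherit from the limit that both multipliers at \<open>i\<close> are
  nonzero and one is negative. Since neither vanishes, \<open>i\<close> can only be biactive in the
  QPCC, where S-stationarity demands that both be nonnegative.\<close>

lemma sqpcc_iterates_no_spurious_limit:
  assumes z: "sqpcc_iterates P M z" "z \<longlonglongrightarrow> (w, la, \<mu>, \<xi>, \<nu>)"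
    and nonS: "non_S_stationary P (w, la, \<mu>, \<xi>, \<nu>)"
    and nonzero: "\<And>i. i \<in> I00 P w \<Longrightarrow> \<xi> $ i \<noteq> 0 \<and> \<nu> $ i \<noteq> 0"
  shows False
proof -
  obtain i where i: "i \<in> I00 P w" "\<xi> $ i < 0 \<or> \<nu> $ i < 0"
    using nonS unfolding non_S_stationary_def S_stationary.simps
    by (auto simp: not_le simp del: W_stationary.simps)
  \<comment> \<open>The multipliers of the QPCC at \<open>z k\<close> are components of
    \<open>z (Suc k)\<close>, hence the shift.\<close>
  have \<xi>: "(\<lambda>k. fst (snd (snd (snd (z (Suc k))))) $ i) \<longlonglongrightarrow> \<xi> $ i"
    and \<nu>: "(\<lambda>k. snd (snd (snd (snd (z (Suc k))))) $ i) \<longlonglongrightarrow> \<nu> $ i"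
    using LIMSEQ_Suc[OF z(2)] by (auto intro!: tendsto_eq_intros)
  have "\<forall>\<^sub>F k in sequentially. fst (snd (snd (snd (z (Suc k))))) $ i < 0 \<or>
      snd (snd (snd (snd (z (Suc k))))) $ i < 0"
    using i(2) order_tendstoD(2)[OF \<xi>, of 0] order_tendstoD(2)[OF \<nu>, of 0]
    by (auto elim: eventually_mono)
  then have "\<forall>\<^sub>F k in sequentially. fst (snd (snd (snd (z (Suc k))))) $ i \<noteq> 0 \<and>
      snd (snd (snd (snd (z (Suc k))))) $ i \<noteq> 0 \<and>
      (fst (snd (snd (snd (z (Suc k))))) $ i < 0 \<or> snd (snd (snd (snd (z (Suc k))))) $ i < 0)"
    using nonzero[OF i(1)]
    by (intro eventually_conj tendsto_imp_eventually_ne[OF \<xi>] tendsto_imp_eventually_ne[OF \<nu>]) auto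
  then obtain k where k: "fst (snd (snd (snd (z (Suc k))))) $ i \<noteq> 0"
      "snd (snd (snd (snd (z (Suc k))))) $ i \<noteq> 0"
      "fst (snd (snd (snd (z (Suc k))))) $ i < 0 \<or> snd (snd (snd (snd (z (Suc k))))) $ i < 0"
    by (auto simp: eventually_sequentially)
  obtain w' la' \<mu>' \<xi>' \<nu>' where zk: "z (Suc k) = (w', la', \<mu>', \<xi>', \<nu>')"
    by (cases "z (Suc k)")
  let ?G = "linearization (mpcc_G P) (fst (z k)) (w' - fst (z k)) $ i"
  let ?H = "linearization (mpcc_H P) (fst (z k)) (w' - fst (z k)) $ i"
  have "qpcc_S_stationary P (fst (z k)) (M k (z k)) (w' - fst (z k), la', \<mu>', \<xi>', \<nu>')"
    using z(1)[unfolded sqpcc_iterates_def, rule_format, of k] zk by simp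
  then have "0 \<le> ?G \<and> 0 \<le> ?H \<and> ?G * ?H = 0" "?G = 0 \<and> ?H > 0 \<longrightarrow> \<nu>' $ i = 0"
      "?G > 0 \<and> ?H = 0 \<longrightarrow> \<xi>' $ i = 0" "?G = 0 \<and> ?H = 0 \<longrightarrow> 0 \<le> \<xi>' $ i \<and> 0 \<le> \<nu>' $ i"
    unfolding qpcc_S_stationary.simps Let_def linearization_def[symmetric] by auto
  then show False
    using k unfolding zk fst_conv snd_conv by (auto simp: less_le)
qed

text \<open>Resolves the implicit inequality for \<open>e'\<close>. After (e' + e)^2 \<le> 2 (e'^2 +
  e^2), the terms in \<open>e'\<close> on the right amount to at most (1/3 + 1/8) e' = 11/24 e'.
  Absorbing them costs a factor 24/13, rounded up to 2.\<close>

lemma perturbed_newton_estimate: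
  fixes e e' :: real
  assumes "0 \<le> e" "0 \<le> e'" "e' \<le> \<epsilon>" "0 \<le> \<gamma>" "0 \<le> \<kappa>" "0 \<le> \<omega>"
    and \<kappa>: "\<gamma> * \<kappa> \<le> 1/3" and \<epsilon>: "4 * \<gamma> * \<omega> * \<epsilon> \<le> 1/4"
    and le: "e' \<le> \<gamma> * (\<kappa> * (e' + e) + \<omega> * (e' + e)\<^sup>2)"
  shows "e' \<le> 2 * \<gamma> * \<kappa> * e + 4 * \<gamma> * \<omega> * e\<^sup>2"
proof -
  have "(e' + e)\<^sup>2 \<le> 2 * (e'\<^sup>2 + e\<^sup>2)"
    using sum_squares_bound[of e' e] by (simp add: power2_sum)
  then have 1: "\<gamma> * \<omega> * (e' + e)\<^sup>2 \<le> \<gamma> * \<omega> * (2 * (e'\<^sup>2 + e\<^sup>2))"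
    using assms by (intro mult_left_mono) auto
  have "4 * \<gamma> * \<omega> * e' \<le> 4 * \<gamma> * \<omega> * \<epsilon>"
    using assms by (intro mult_left_mono) auto
  then have "4 * \<gamma> * \<omega> * e' \<le> 1/4"
    using \<epsilon> by linarith
  then have 2: "(4 * \<gamma> * \<omega> * e') * e' \<le> 1/4 * e'"
    using assms by (intro mult_right_mono) auto
  have 3: "(\<gamma> * \<kappa>) * e' \<le> 1/3 * e'"
    using assms by (intro mult_right_mono) auto
  have "0 \<le> \<gamma> * \<kappa> * e" "0 \<le> \<gamma> * \<omega> * e\<^sup>2"
    using assms by auto
  then show ?thesis
    using 1 2 3 le by (simp add: algebra_simps power2_eq_square)
qed

text \<open>All local facts on one closed ball, closed because Brouwer's theorem is applied to it.
  Two of its points are at most \<open>2 * \<epsilon>\<close> apart, so the assumption on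
  \<open>\<rho>\<close> keeps every remainder within the domain where the solution maps are
  controlled.\<close>

locale sqpcc_neighborhood =
  fixes P :: "('n::finite, 'h::finite, 'g::finite, 'm::finite) mpcc"
    and M :: "nat \<Rightarrow> ('n, 'h, 'g, 'm) pdvar \<Rightarrow> real^'n^'n"
    and zbar :: "('n, 'h, 'g, 'm) pdvar"
    and s :: "'m set \<Rightarrow> ('n, 'h, 'g, 'm) pdvar \<Rightarrow> ('n, 'h, 'g, 'm) pdvar"
    and \<gamma> \<omega> \<epsilon> \<rho> :: real and \<kappa> :: "nat \<Rightarrow> real"
  assumes pos: "0 < \<gamma>" "0 < \<omega>" "0 < \<epsilon>" "\<And>k. 0 \<le> \<kappa> k"
    and \<kappa>: "\<And>k. \<gamma> * \<kappa> k < 1/3"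
    and \<epsilon>: "4 * \<gamma> * \<omega> * \<epsilon> \<le> 1/4"
    and \<rho>: "\<And>k. \<kappa> k * (2 * \<epsilon>) + \<omega> * (2 * \<epsilon>)\<^sup>2 < \<rho>"
    and feas: "feasible P (fst zbar)"
    and M: "\<And>k z. pos_def (M k z)"
    and smooth: "\<And>z. z \<in> cball zbar \<epsilon> \<Longrightarrow> \<forall>\<^sub>F v in nhds (fst z). smooth_at P v"
    and LICQ: "\<And>z. z \<in> cball zbar \<epsilon> \<Longrightarrow> LICQ_nearby P (fst zbar) (fst z)"
    and active: "\<And>z z'. z \<in> cball zbar \<epsilon> \<Longrightarrow> z' \<in> cball zbar \<epsilon> \<Longrightarrow>
      active_nearby P (fst zbar) (fst z) (fst z' - fst z)"
    and Lipschitz: "\<And>z zk. z \<in> cball zbar \<epsilon> \<Longrightarrow> zk \<in> cball zbar \<epsilon> \<Longrightarrow>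
      onorm (\<lambda>x. Psi_jac P z x - Psi_jac P zk x) \<le> \<omega> * norm (z - zk)"
    and approx: "\<And>k zk. zk \<in> cball zbar \<epsilon> \<Longrightarrow>
      onorm (\<lambda>x. Psi_jac P zk x - Psi_jac_approx P (M k zk) zk x) \<le> \<kappa> k"
    and sol_continuous: "\<And>I. I \<in> partitions P (fst zbar) \<Longrightarrow> continuous_on (ball 0 \<rho>) (s I)"
    and sol_bound: "\<And>I r. I \<in> partitions P (fst zbar) \<Longrightarrow> r \<in> ball 0 \<rho> \<Longrightarrow>
      norm (s I r - zbar) \<le> \<gamma> * norm r"
    and sol_KKT: "\<And>I r. I \<in> partitions P (fst zbar) \<Longrightarrow> r \<in> ball 0 \<rho> \<Longrightarrow> branch_KKT P I r (s I r)"
    and sol_unique: "\<And>I r z. I \<in> partitions P (fst zbar) \<Longrightarrow> r \<in> ball 0 \<rho> \<Longrightarrow> z \<in> cball zbar \<epsilon> \<Longrightarrow>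
      branch_KKT P I r z \<Longrightarrow> z = s I r"
begin

abbreviation step :: "nat \<Rightarrow> ('n, 'h, 'g, 'm) pdvar \<Rightarrow> ('n, 'h, 'g, 'm) pdvar \<Rightarrow> bool" where
  "step k zk z \<equiv> qpcc_S_stationary P (fst zk) (M k zk) (fst z - fst zk, snd z)"

lemma norm_diff_le:
  assumes "zk \<in> cball zbar \<epsilon>" "z \<in> cball zbar \<epsilon>"
  shows "norm (z - zk) \<le> norm (z - zbar) + norm (zk - zbar)" "norm (z - zk) \<le> 2 * \<epsilon>"
proof -
  show *: "norm (z - zk) \<le> norm (z - zbar) + norm (zk - zbar)"
    using norm_triangle_ineq4[of "z - zbar" "zk - zbar"] by simp
  then show "norm (z - zk) \<le> 2 * \<epsilon>"
    using assms by (simp add: dist_norm norm_minus_commute)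
qed

lemma remainder_le:
  assumes "zk \<in> cball zbar \<epsilon>" "z \<in> cball zbar \<epsilon>"
  shows "norm (newton_remainder P (M k zk) zk z) \<le> \<kappa> k * norm (z - zk) + \<omega> * (norm (z - zk))\<^sup>2"
  by (rule norm_remainder_le[of "cball zbar \<epsilon>"])
     (use assms pos in \<open>auto intro!: smooth Lipschitz approx simp del: mem_cball\<close>)

lemma mono_bound:
  assumes "0 \<le> t" "t \<le> u"
  shows "\<kappa> k * t + \<omega> * t\<^sup>2 \<le> \<kappa> k * u + \<omega> * u\<^sup>2"
  using assms pos by (intro add_mono mult_left_mono power_mono) (auto intro: less_imp_le)

lemma remainder_small:
  assumes "zk \<in> cball zbar \<epsilon>" "z \<in> cball zbar \<epsilon>"
  shows "norm (newton_remainder P (M k zk) zk z) \<le> \<kappa> k * (2 * \<epsilon>) + \<omega> * (2 * \<epsilon>)\<^sup>2"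
    and "newton_remainder P (M k zk) zk z \<in> ball 0 \<rho>"
proof -
  show *: "norm (newton_remainder P (M k zk) zk z) \<le> \<kappa> k * (2 * \<epsilon>) + \<omega> * (2 * \<epsilon>)\<^sup>2"
    using remainder_le[OF assms, of k] mono_bound[of "norm (z - zk)" "2 * \<epsilon>" k] norm_diff_le(2)[OF assms]
    by simp
  show "newton_remainder P (M k zk) zk z \<in> ball 0 \<rho>"
    using * \<rho>[of k] by simp
qed

lemma branch_step_exists:
  assumes I: "I \<in> partitions P (fst zbar)" and zk: "zk \<in> cball zbar \<epsilon>"
  shows "\<exists>z\<in>cball zbar \<epsilon>. branch_qp_KKT P I (fst zk) (M k zk) (fst z - fst zk, snd z)"
proof -
  let ?r = "newton_remainder P (M k zk) zk"
  have "continuous_on (cball zbar \<epsilon>) (\<lambda>z. s I (?r z))"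
    by (rule continuous_on_compose2[OF sol_continuous[OF I] continuous_on_remainder])
       (use remainder_small(2)[OF zk] smooth zk in \<open>auto simp del: mem_cball mem_ball\<close>)
  moreover have "s I (?r z) \<in> cball zbar \<epsilon>" if z: "z \<in> cball zbar \<epsilon>" for z
  proof -
    have "norm (s I (?r z) - zbar) \<le> \<gamma> * norm (?r z)"
      by (rule sol_bound[OF I remainder_small(2)[OF zk z]])
    also have "\<dots> \<le> \<gamma> * (\<kappa> k * (2 * \<epsilon>) + \<omega> * (2 * \<epsilon>)\<^sup>2)"
      using pos by (intro mult_left_mono remainder_small(1)[OF zk z]) auto
    \<comment> \<open>The factor of \<open>\<epsilon>\<close> is at most 2/3 + 1/4, so the ball is
      mapped into itself.\<close>
    also have "\<dots> = (2 * (\<gamma> * \<kappa> k) + 4 * \<gamma> * \<omega> * \<epsilon>) * \<epsilon>"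
      by (simp add: algebra_simps power2_eq_square)
    also have "\<dots> \<le> 1 * \<epsilon>"
      using \<kappa>[of k] \<epsilon> pos by (intro mult_right_mono) auto
    finally show ?thesis
      by (simp add: dist_norm norm_minus_commute)
  qed
  ultimately obtain z where z: "z \<in> cball zbar \<epsilon>" "s I (?r z) = z"
    using brouwer_ball[OF pos(3), of zbar "\<lambda>z. s I (?r z)"] by blast
  have "branch_KKT P I (?r z) z"
    using sol_KKT[OF I remainder_small(2)[OF zk z(1)], of k] z(2) by simp
  then show ?thesis
    using z(1) branch_KKT_remainder_iff[OF smooth[OF zk]] by blast
qed

lemma step_exists:
  assumes zk: "zk \<in> cball zbar \<epsilon>"
  shows "\<exists>z\<in>cball zbar \<epsilon>. step k zk z"
proof -
  obtain Z where Z: "\<And>I. I \<in> partitions P (fst zbar) \<Longrightarrow> Z I \<in> cball zbar \<epsilon> \<and>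
      branch_qp_KKT P I (fst zk) (M k zk) (fst (Z I) - fst zk, snd (Z I))"
    using branch_step_exists[OF _ zk, of _ k] by metis
  have "\<exists>I\<in>partitions P (fst zbar). qpcc_S_stationary P (fst zk) (M k zk) (fst (Z I) - fst zk, snd (Z I))"
    by (rule exists_qpcc_S_stationary[OF M LICQ[OF zk]]) (use Z active[OF zk] in auto)
  then show ?thesis
    using Z by blast
qed

lemma step_estimate:
  assumes zk: "zk \<in> cball zbar \<epsilon>" and z: "z \<in> cball zbar \<epsilon>" and "step k zk z"
  shows "norm (z - zbar) \<le> 2 * \<gamma> * \<kappa> k * norm (zk - zbar) + 4 * \<gamma> * \<omega> * (norm (zk - zbar))\<^sup>2"
proof -
  let ?r = "newton_remainder P (M k zk) zk z"
  obtain la \<mu> \<xi> \<nu> where y: "snd z = (la, \<mu>, \<xi>, \<nu>)"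
    by (cases "snd z")
  obtain I where I: "I \<in> partitions P (fst zbar)"
    and KKT: "branch_qp_KKT P I (fst zk) (M k zk) (fst z - fst zk, snd z)"
    using qpcc_S_stationary_imp_branch_qp_KKT[OF _ active[OF zk z] feas] assms(3) unfolding y by blast
  note r = remainder_small(2)[OF zk z, of k]
  \<comment> \<open>Local uniqueness turns an arbitrary step within the ball into a value of the
    solution map, whose bound then applies.\<close>
  have "z = s I ?r"
    using KKT branch_KKT_remainder_iff[OF smooth[OF zk]] sol_unique[OF I r z] by blast
  then have "norm (z - zbar) \<le> \<gamma> * norm ?r"
    using sol_bound[OF I r] by simp
  also have "\<dots> \<le> \<gamma> * (\<kappa> k * norm (z - zk) + \<omega> * (norm (z - zk))\<^sup>2)"
    using remainder_le[OF zk z] pos by (intro mult_left_mono) auto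
  also have "\<dots> \<le> \<gamma> * (\<kappa> k * (norm (z - zbar) + norm (zk - zbar)) + \<omega> * (norm (z - zbar) + norm (zk - zbar))\<^sup>2)"
    using norm_diff_le(1)[OF zk z] pos by (intro mult_left_mono mono_bound) auto
  finally show ?thesis
    using pos \<kappa>[of k] \<epsilon> z
    by (intro perturbed_newton_estimate[of _ _ \<epsilon>]) (auto simp: dist_norm norm_minus_commute)
qed

lemma step_contraction:
  assumes "zk \<in> cball zbar \<epsilon>" "z \<in> cball zbar \<epsilon>" "step k zk z"
  shows "norm (z - zbar) \<le> 11/12 * norm (zk - zbar)"
proof -
  let ?e = "norm (zk - zbar)"
  have "?e \<le> \<epsilon>"
    using assms(1) by (simp add: dist_norm norm_minus_commute)
  then have "4 * \<gamma> * \<omega> * ?e \<le> 4 * \<gamma> * \<omega> * \<epsilon>"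
    using pos by (intro mult_left_mono) auto
  then have "2 * (\<gamma> * \<kappa> k) + 4 * \<gamma> * \<omega> * ?e \<le> 11/12"
    using \<kappa>[of k] \<epsilon> by linarith
  then have "(2 * (\<gamma> * \<kappa> k) + 4 * \<gamma> * \<omega> * ?e) * ?e \<le> 11/12 * ?e"
    by (intro mult_right_mono) auto
  then show ?thesis
    using step_estimate[OF assms] by (simp add: algebra_simps power2_eq_square)
qed

lemma iterates_converge:
  assumes z: "sqpcc_iterates P M z" "\<And>k. z k \<in> cball zbar \<epsilon>"
  shows "z \<longlonglongrightarrow> zbar"
proof -
  have step: "norm (z (Suc k) - zbar) \<le> 11/12 * norm (z k - zbar)" for k
    using z by (intro step_contraction[of _ _ k]) (auto simp: sqpcc_iterates_def)
  have "norm (z k - zbar) \<le> (11/12) ^ k * norm (z 0 - zbar)" for k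
  proof (induction k)
    case (Suc k)
    then show ?case
      using step[of k] by simp
  qed simp
  then have "\<forall>\<^sub>F k in sequentially. norm (z k - zbar) \<le> (11/12) ^ k * norm (z 0 - zbar)"
    by (rule always_eventually[OF allI])
  moreover have "(\<lambda>k. (11/12) ^ k * norm (z 0 - zbar)) \<longlonglongrightarrow> 0"
    by (intro tendsto_mult_left_zero LIMSEQ_power_zero) simp
  ultimately have "(\<lambda>k. z k - zbar) \<longlonglongrightarrow> 0"
    by (rule Lim_null_comparison)
  then show ?thesis
    by (simp add: LIM_zero_iff)
qed

lemma iterates_exist:
  assumes "z0 \<in> cball zbar \<epsilon>"
  shows "\<exists>z. z 0 = z0 \<and> sqpcc_iterates P M z \<and> (\<forall>k. z k \<in> cball zbar \<epsilon>)"
proof -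
  \<comment> \<open>Membership in the ball is the invariant that permits the next step; the clause
    for \<open>k = 0\<close> fixes the starting point.\<close>
  have "\<exists>z. \<forall>k. (z k \<in> cball zbar \<epsilon> \<and> (k = 0 \<longrightarrow> z k = z0)) \<and> step k (z k) (z (Suc k))"
  proof (rule dependent_nat_choice)
    show "\<exists>x. x \<in> cball zbar \<epsilon> \<and> (0 = 0 \<longrightarrow> x = z0)"
      using assms by blast
    show "\<exists>y. (y \<in> cball zbar \<epsilon> \<and> (Suc k = 0 \<longrightarrow> y = z0)) \<and> step k x y"
      if "x \<in> cball zbar \<epsilon> \<and> (k = 0 \<longrightarrow> x = z0)" for x k
      using step_exists[of x k] that by blast
  qed
  then show ?thesis
    unfolding sqpcc_iterates_def by blast
qed

lemma convergence_rate:
  assumes z: "sqpcc_iterates P M z" "\<And>k. z k \<in> cball zbar \<epsilon>"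
    and \<kappa>bar: "\<And>k. \<kappa> k \<le> \<kappa>bar"
  shows "\<exists>\<alpha> \<beta>. (\<forall>k. \<alpha> k \<in> {0..<1}) \<and> \<beta> > 0 \<and>
            (\<forall>k. norm (z (Suc k) - zbar) \<le> \<alpha> k * norm (z k - zbar) + \<beta> * (norm (z k - zbar))\<^sup>2) \<and>
            (\<kappa> \<longlonglongrightarrow> 0 \<longrightarrow> \<alpha> \<longlonglongrightarrow> 0 \<and> superlinearly_converges z zbar) \<and>
            (\<kappa>bar = 0 \<longrightarrow> (\<forall>k. \<alpha> k = 0) \<and> quadratically_converges z zbar)"
proof -
  define \<alpha> where "\<alpha> k = 2 * \<gamma> * \<kappa> k" for k
  define \<beta> where "\<beta> = 4 * \<gamma> * \<omega>"
  have lim: "z \<longlonglongrightarrow> zbar"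
    by (rule iterates_converge[OF z])
  have est: "norm (z (Suc k) - zbar) \<le> \<alpha> k * norm (z k - zbar) + \<beta> * (norm (z k - zbar))\<^sup>2" for k
    using z step_estimate[of "z k" "z (Suc k)" k] by (simp add: sqpcc_iterates_def \<alpha>_def \<beta>_def)
  have "\<alpha> \<longlonglongrightarrow> 0 \<and> superlinearly_converges z zbar" if "\<kappa> \<longlonglongrightarrow> 0"
  proof -
    have 1: "\<alpha> \<longlonglongrightarrow> 0"
      unfolding \<alpha>_def using that by (rule tendsto_mult_right_zero)
    have "(\<lambda>k. norm (z k - zbar)) \<longlonglongrightarrow> 0"
      using lim by (simp add: LIM_zero tendsto_norm_zero)
    \<comment> \<open>One factor of the quadratic term is moved into the coefficient, which then
      tends to 0.\<close>
    then have "(\<lambda>k. \<alpha> k + \<beta> * norm (z k - zbar)) \<longlonglongrightarrow> 0"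
      using tendsto_add[OF 1 tendsto_mult_right_zero] by simp
    moreover have "dist (z (Suc k)) zbar \<le> (\<alpha> k + \<beta> * norm (z k - zbar)) * dist (z k) zbar" for k
      using est[of k] by (simp add: dist_norm algebra_simps power2_eq_square)
    ultimately show ?thesis
      using 1 lim unfolding superlinearly_converges_def by blast
  qed
  moreover have "(\<forall>k. \<alpha> k = 0) \<and> quadratically_converges z zbar" if "\<kappa>bar = 0"
  proof -
    have "\<kappa> k = 0" for k
      using \<kappa>bar[of k] pos(4)[of k] that by simp
    then have 1: "\<alpha> k = 0" for k
      by (simp add: \<alpha>_def)
    then have "\<forall>k. dist (z (Suc k)) zbar \<le> \<beta> * (dist (z k) zbar)\<^sup>2"
      using est by (simp add: dist_norm)
    then show ?thesis
      using 1 lim unfolding quadratically_converges_def by blast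
  qed
  moreover have "\<alpha> k \<in> {0..<1}" for k
    using \<kappa>[of k] pos(1) pos(4)[of k] by (simp add: \<alpha>_def)
  moreover have "\<beta> > 0"
    using pos by (simp add: \<beta>_def)
  ultimately show ?thesis
    using est by blast
qed

end

section \<open>Choice of the radii and proof of the theorem\<close>

lemma branch_Lipschitz_constant_ball:
  assumes "branch_Lipschitz_constant P zbar I c" "c \<le> \<gamma>"
  shows "\<exists>s. \<exists>\<rho>>0. continuous_on (ball 0 \<rho>) s \<and> (\<forall>r\<in>ball 0 \<rho>. norm (s r - zbar) \<le> \<gamma> * norm r \<and>
    branch_KKT P I r (s r) \<and> (\<forall>z\<in>ball zbar \<rho>. branch_KKT P I r z \<longrightarrow> z = s r))"
proof -
  obtain s where s: "branch_solution_map P zbar I s"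
    and ev: "\<forall>\<^sub>F r in nhds 0. norm (s r - zbar) \<le> c * norm r"
    using assms(1) by (auto simp: branch_Lipschitz_constant_def)
  obtain \<rho>1 N where 1: "\<rho>1 > 0" "open N" "zbar \<in> N" "continuous_on (ball 0 \<rho>1) s"
    and sol: "\<And>r. r \<in> ball 0 \<rho>1 \<Longrightarrow> {z \<in> N. branch_KKT P I r z} = {s r}"
    using s unfolding branch_solution_map_def by blast
  obtain \<rho>2 where 2: "\<rho>2 > 0" "\<And>r. r \<in> ball 0 \<rho>2 \<Longrightarrow> norm (s r - zbar) \<le> c * norm r"
    using ev unfolding eventually_nhds_metric by (auto simp: dist_commute)
  obtain \<rho>3 where 3: "\<rho>3 > 0" "ball zbar \<rho>3 \<subseteq> N"
    using 1(2,3) openE by blast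
  \<comment> \<open>One radius for the perturbations, the Lipschitz bound and the ball of
    uniqueness, so that only one number per branch has to be handled.\<close>
  let ?\<rho> = "min \<rho>1 (min \<rho>2 \<rho>3)"
  have "norm (s r - zbar) \<le> \<gamma> * norm r" if "r \<in> ball 0 ?\<rho>" for r
  proof -
    have "norm (s r - zbar) \<le> c * norm r"
      using that by (intro 2) simp
    also have "\<dots> \<le> \<gamma> * norm r"
      using assms(2) by (intro mult_right_mono) auto
    finally show ?thesis .
  qed
  moreover have "branch_KKT P I r (s r)" "z \<in> ball zbar ?\<rho> \<Longrightarrow> branch_KKT P I r z \<Longrightarrow> z = s r"
    if "r \<in> ball 0 ?\<rho>" for r z
  proof -
    have r: "{z \<in> N. branch_KKT P I r z} = {s r}"
      using that by (intro sol) simp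
    then show "branch_KKT P I r (s r)"
      by blast
    show "z = s r" if "z \<in> ball zbar ?\<rho>" "branch_KKT P I r z"
    proof -
      have "z \<in> N"
        using that(1) 3(2) by auto
      then show ?thesis
        using r that(2) by blast
    qed
  qed
  moreover have "continuous_on (ball 0 ?\<rho>) s"
    by (rule continuous_on_subset[OF 1(4)]) auto
  ultimately show ?thesis
    using 1(1) 2(1) 3(1) by (intro exI[of _ s] exI[of _ ?\<rho>]) auto
qed

text \<open>Turns conditions on points into conditions on radii, so that all requirements on
  \<epsilon> can be intersected in the filter \<open>at_right 0\<close>.\<close>

lemma eventually_ball_cball:
  fixes x :: "'a::metric_space"
  assumes "\<forall>\<^sub>F y in nhds x. Q y"
  shows "\<forall>\<^sub>F e in at_right (0::real). \<forall>y\<in>cball x e. Q y"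
proof -
  obtain d where "d > 0" "\<And>y. dist y x < d \<Longrightarrow> Q y"
    using assms unfolding eventually_nhds_metric by blast
  then show ?thesis
    unfolding eventually_at_right_field by (intro exI[of _ d]) (auto simp: dist_commute)
qed

theorem corollary5p1:
  fixes P :: "('n::finite, 'h::finite, 'g::finite, 'm::finite) mpcc"
    and wbar :: "real^'n" and lbar :: "real^'h" and \<mu>bar :: "real^'g"
    and \<xi>bar \<nu>bar :: "real^'m"
    and zbar :: "('n, 'h, 'g, 'm) pdvar"
    and \<gamma>I :: "'m set \<Rightarrow> real" and \<gamma> \<omega> \<kappa>bar \<delta> :: real and \<kappa> :: "nat \<Rightarrow> real"
    and M :: "nat \<Rightarrow> ('n, 'h, 'g, 'm) pdvar \<Rightarrow> real^'n^'n"
    and V :: "('n, 'h, 'g, 'm) pdvar set"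
  assumes zbar: "zbar = (wbar, lbar, \<mu>bar, \<xi>bar, \<nu>bar)"
    and smooth: "smooth_data P wbar"
    and loc_sol: "local_solution P wbar"
    and LICQ: "mpcc_LICQ P wbar"
    and SSOSC: "mpcc_SSOSC P zbar"
    and \<gamma>I: "\<forall>I\<in>partitions P wbar. branch_Lipschitz_constant P zbar I (\<gamma>I I)"
    and \<gamma>: "\<gamma> = Max (\<gamma>I ` partitions P wbar)" "\<gamma> > 0"
    and M: "\<forall>k z. pos_def (M k z)"
    and V: "open V" "zbar \<in> V"
    and \<omega>: "\<omega> > 0"
    and \<kappa>bar: "\<kappa>bar < 1 / (3 * \<gamma>)"
    and \<kappa>: "\<forall>k. \<kappa> k \<in> {0..\<kappa>bar}"
    and Lipschitz: "\<forall>zk\<in>V. \<forall>z\<in>V.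
          onorm (\<lambda>x. Psi_jac P z x - Psi_jac P zk x) \<le> \<omega> * norm (z - zk)"
    and approx: "\<forall>k. \<forall>zk\<in>V.
          onorm (\<lambda>x. Psi_jac P zk x - Psi_jac_approx P (M k zk) zk x) \<le> \<kappa> k"
    and \<delta>: "\<delta> > 0"
    and nonzero: "\<forall>w la \<mu> \<xi> \<nu>. non_S_stationary P (w, la, \<mu>, \<xi>, \<nu>) \<and> dist w wbar < \<delta> \<longrightarrow>
          (\<forall>i\<in>I00 P w. \<xi> $ i \<noteq> 0 \<and> \<nu> $ i \<noteq> 0)"
  shows "\<exists>\<epsilon>>0. \<exists>U. ball zbar \<epsilon> \<subseteq> U \<and>
      (\<forall>z0\<in>U. \<exists>z. z 0 = z0 \<and> sqpcc_iterates P M z \<and> z \<longlonglongrightarrow> zbar \<and>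
         (\<exists>\<alpha> \<beta>. (\<forall>k. \<alpha> k \<in> {0..<1}) \<and> \<beta> > 0 \<and>
            (\<forall>k. norm (z (Suc k) - zbar) \<le> \<alpha> k * norm (z k - zbar) + \<beta> * (norm (z k - zbar))\<^sup>2) \<and>
            (\<kappa> \<longlonglongrightarrow> 0 \<longrightarrow> \<alpha> \<longlonglongrightarrow> 0 \<and> superlinearly_converges z zbar) \<and>
            (\<kappa>bar = 0 \<longrightarrow> (\<forall>k. \<alpha> k = 0) \<and> quadratically_converges z zbar))) \<and>
      (\<not> (\<exists>z w la \<mu> \<xi> \<nu>. sqpcc_iterates P M z \<and> z 0 \<in> U \<and>
            non_S_stationary P (w, la, \<mu>, \<xi>, \<nu>) \<and> dist w wbar < \<delta> \<and>
            z \<longlonglongrightarrow> (w, la, \<mu>, \<xi>, \<nu>))) \<and>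
      (\<forall>z. sqpcc_iterates P M z \<and> (\<forall>k. z k \<in> U) \<longrightarrow> z \<longlonglongrightarrow> zbar)"
proof -
  have feas: "feasible P wbar"
    using loc_sol by (simp add: local_solution_def)
  have fin: "finite (partitions P wbar)" "partitions P wbar \<noteq> {}"
    by (auto simp: partitions_def)
  have "\<forall>I\<in>partitions P wbar. \<exists>s. \<exists>\<rho>>0. continuous_on (ball 0 \<rho>) s \<and>
      (\<forall>r\<in>ball 0 \<rho>. norm (s r - zbar) \<le> \<gamma> * norm r \<and> branch_KKT P I r (s r) \<and>
        (\<forall>z\<in>ball zbar \<rho>. branch_KKT P I r z \<longrightarrow> z = s r))"
  proof
    fix I
    assume I: "I \<in> partitions P wbar"
    then have "\<gamma>I I \<le> \<gamma>"
      using fin \<gamma>(1) by simp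
    with \<gamma>I I show "\<exists>s. \<exists>\<rho>>0. continuous_on (ball 0 \<rho>) s \<and>
      (\<forall>r\<in>ball 0 \<rho>. norm (s r - zbar) \<le> \<gamma> * norm r \<and> branch_KKT P I r (s r) \<and>
        (\<forall>z\<in>ball zbar \<rho>. branch_KKT P I r z \<longrightarrow> z = s r))"
      by (intro branch_Lipschitz_constant_ball) auto
  qed
  then obtain s where "\<forall>I\<in>partitions P wbar. \<exists>\<rho>>0. continuous_on (ball 0 \<rho>) (s I) \<and>
      (\<forall>r\<in>ball 0 \<rho>. norm (s I r - zbar) \<le> \<gamma> * norm r \<and> branch_KKT P I r (s I r) \<and>
        (\<forall>z\<in>ball zbar \<rho>. branch_KKT P I r z \<longrightarrow> z = s I r))"
    by (rule bchoice[THEN exE])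
  then obtain R where R: "\<forall>I\<in>partitions P wbar. R I > 0 \<and> continuous_on (ball 0 (R I)) (s I) \<and>
      (\<forall>r\<in>ball 0 (R I). norm (s I r - zbar) \<le> \<gamma> * norm r \<and> branch_KKT P I r (s I r) \<and>
        (\<forall>z\<in>ball zbar (R I). branch_KKT P I r z \<longrightarrow> z = s I r))"
    by (rule bchoice[THEN exE])
  define \<rho> where "\<rho> = Min (R ` partitions P wbar)"
  have "\<rho> > 0"
    using R fin by (auto simp: \<rho>_def)
  have le: "\<rho> \<le> R I" if "I \<in> partitions P wbar" for I
    using that fin by (simp add: \<rho>_def)
  have bar: "fst zbar = wbar"
    by (simp add: zbar)
  have fst: "filterlim fst (nhds wbar) (nhds zbar)"
    using tendsto_fst[OF filterlim_ident, of zbar] by (simp add: bar)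
  \<comment> \<open>\<open>active_nearby\<close> involves two points. The product filter supplies
    one condition \<open>Q\<close> that can be imposed on each point separately, hence on a
    ball.\<close>
  obtain Q where Q: "\<forall>\<^sub>F w in nhds wbar. Q w"
    and active: "\<And>w w'. Q w \<Longrightarrow> Q w' \<Longrightarrow> active_nearby P wbar w (w' - w)"
    using eventually_active_nearby[OF smooth feas] unfolding nhds_prod eventually_prod_same by auto
  have "\<forall>\<^sub>F w in nhds wbar. (\<forall>\<^sub>F v in nhds w. smooth_at P v) \<and> LICQ_nearby P wbar w \<and> Q w"
    using eventually_smooth_at[OF smooth] eventually_LICQ_nearby[OF smooth LICQ] Q
    by (simp add: eventually_conj_iff eventually_eventually)
  moreover have "\<forall>\<^sub>F z in nhds zbar. z \<in> V"
    using V by (rule eventually_nhds_in_open)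
  ultimately have "\<forall>\<^sub>F z in nhds zbar. z \<in> V \<and> (\<forall>\<^sub>F v in nhds (fst z). smooth_at P v) \<and>
      LICQ_nearby P wbar (fst z) \<and> Q (fst z)"
    using eventually_compose_filterlim[OF _ fst] eventually_conj by blast
  from eventually_ball_cball[OF this]
  have ev1: "\<forall>\<^sub>F e in at_right 0. \<forall>z\<in>cball zbar e. z \<in> V \<and> (\<forall>\<^sub>F v in nhds (fst z). smooth_at P v) \<and>
      LICQ_nearby P wbar (fst z) \<and> Q (fst z)" .
  \<comment> \<open>Using \<open>\<kappa>bar\<close> in place of \<open>\<kappa> k\<close> makes the
    radius independent of the iteration.\<close>
  have ev2: "\<forall>\<^sub>F e in at_right 0. \<kappa>bar * (2 * e) + \<omega> * (2 * e)\<^sup>2 < \<rho>"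
    by (rule order_tendstoD(2)[OF _ \<open>\<rho> > 0\<close>]) (auto intro!: tendsto_eq_intros)
  have ev3: "\<forall>\<^sub>F e in at_right (0::real). 4 * \<gamma> * \<omega> * e < 1/4"
    by (rule order_tendstoD(2)[where y = 0]) (auto intro!: tendsto_eq_intros)
  \<comment> \<open>Puts the closed ball inside the ball of uniqueness of every branch.\<close>
  have ev4: "\<forall>\<^sub>F e in at_right (0::real). e < \<rho>"
    using \<open>\<rho> > 0\<close> by (rule order_tendstoD(2)[OF tendsto_ident_at])
  have ev5: "\<forall>\<^sub>F e in at_right (0::real). 0 < e"
    by (rule eventually_at_right_less)
  obtain \<epsilon> where small: "\<forall>z\<in>cball zbar \<epsilon>. z \<in> V \<and> (\<forall>\<^sub>F v in nhds (fst z). smooth_at P v) \<and>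
      LICQ_nearby P wbar (fst z) \<and> Q (fst z)" "\<kappa>bar * (2 * \<epsilon>) + \<omega> * (2 * \<epsilon>)\<^sup>2 < \<rho>"
      "4 * \<gamma> * \<omega> * \<epsilon> < 1/4" "\<epsilon> < \<rho>" "0 < \<epsilon>"
    using eventually_happens'[OF trivial_limit_at_right_real
        eventually_conj[OF ev1 eventually_conj[OF ev2 eventually_conj[OF ev3 eventually_conj[OF ev4 ev5]]]]]
    by blast
  have \<kappa>_le: "\<kappa> k \<le> \<kappa>bar" and \<kappa>_ge: "0 \<le> \<kappa> k" for k
    using \<kappa> by auto
  interpret sqpcc_neighborhood P M zbar s \<gamma> \<omega> \<epsilon> \<rho> \<kappa>
  proof
    show "\<gamma> * \<kappa> k < 1/3" for k
    proof -
      have "\<gamma> * \<kappa> k \<le> \<gamma> * \<kappa>bar"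
        using \<kappa>_le \<gamma>(2) by (intro mult_left_mono) auto
      also have "\<dots> < 1/3"
        using \<kappa>bar \<gamma>(2) by (simp add: field_simps)
      finally show ?thesis .
    qed
    show "\<kappa> k * (2 * \<epsilon>) + \<omega> * (2 * \<epsilon>)\<^sup>2 < \<rho>" for k
    proof -
      have "\<kappa> k * (2 * \<epsilon>) \<le> \<kappa>bar * (2 * \<epsilon>)"
        using \<kappa>_le small(5) by (intro mult_right_mono) auto
      then show ?thesis
        using small(2) by simp
    qed
    show "continuous_on (ball 0 \<rho>) (s I)" if "I \<in> partitions P (fst zbar)" for I
      using R that le[of I] unfolding bar by (auto intro: continuous_on_subset)
    show "norm (s I r - zbar) \<le> \<gamma> * norm r" "branch_KKT P I r (s I r)"
      if "I \<in> partitions P (fst zbar)" "r \<in> ball 0 \<rho>" for I r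
      using R that le[of I] unfolding bar by auto
    show "z = s I r" if "I \<in> partitions P (fst zbar)" "r \<in> ball 0 \<rho>" "z \<in> cball zbar \<epsilon>" "branch_KKT P I r z"
      for I r z
    proof -
      have "r \<in> ball 0 (R I)" "z \<in> ball zbar (R I)"
        using that le[of I] small(4) by (auto simp: bar)
      then show ?thesis
        using R that(1,4) unfolding bar by blast
    qed
  qed (use \<gamma>(2) \<omega> small \<kappa>_ge feas M Lipschitz approx active in \<open>auto simp: bar simp del: mem_cball\<close>)
  show ?thesis
  proof (intro exI[of _ \<epsilon>] exI[of _ "cball zbar \<epsilon>"] conjI ballI allI impI notI)
    fix z0
    assume "z0 \<in> cball zbar \<epsilon>"
    from iterates_exist[OF this] obtain z where z: "z 0 = z0" "sqpcc_iterates P M z" "\<And>k. z k \<in> cball zbar \<epsilon>"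
      by blast
    show "\<exists>z. z 0 = z0 \<and> sqpcc_iterates P M z \<and> z \<longlonglongrightarrow> zbar \<and>
         (\<exists>\<alpha> \<beta>. (\<forall>k. \<alpha> k \<in> {0..<1}) \<and> \<beta> > 0 \<and>
            (\<forall>k. norm (z (Suc k) - zbar) \<le> \<alpha> k * norm (z k - zbar) + \<beta> * (norm (z k - zbar))\<^sup>2) \<and>
            (\<kappa> \<longlonglongrightarrow> 0 \<longrightarrow> \<alpha> \<longlonglongrightarrow> 0 \<and> superlinearly_converges z zbar) \<and>
            (\<kappa>bar = 0 \<longrightarrow> (\<forall>k. \<alpha> k = 0) \<and> quadratically_converges z zbar))"
      using z iterates_converge[OF z(2,3)] convergence_rate[OF z(2,3) \<kappa>_le] by blast
  next
    assume "\<exists>z w la \<mu> \<xi> \<nu>. sqpcc_iterates P M z \<and> z 0 \<in> cball zbar \<epsilon> \<and>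
            non_S_stationary P (w, la, \<mu>, \<xi>, \<nu>) \<and> dist w wbar < \<delta> \<and> z \<longlonglongrightarrow> (w, la, \<mu>, \<xi>, \<nu>)"
    then show False
      using nonzero sqpcc_iterates_no_spurious_limit by metis
  next
    fix z
    assume "sqpcc_iterates P M z \<and> (\<forall>k. z k \<in> cball zbar \<epsilon>)"
    then show "z \<longlonglongrightarrow> zbar"
      using iterates_converge by blast
  qed (use small(5) in \<open>auto intro: ball_subset_cball\<close>)
qed

end
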